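(* Let $G$ be a graph on $n$ vertices with a rooted layout $(L, \delta)$. We can solve Subset Vertex Cover in $O(\sum_{x \in V(L)} (\mathsf{nec}_1(V_x))^4 \cdot n^2 \log (\mathsf{nec}_1(V_x)))$ time.
   Context: Subset Vertex Cover is the problem: given a graph $G=(V,E)$, a subset $T\subseteq V$ and a positive integer $k$, decide whether $G$ has a $T$-vertex cover of size at most $k$, where a $T$-vertex cover is a set $S\subseteq V$ containing at least one end-vertex of every edge incident to a vertex of $T$. A rooted layout $(L,\delta)$ consists of a rooted binary tree $L$ and a bijection $\delta$ between $V$ and the leaves of $L$; for a node $x$, $V_x$ is the set of vertices mapped to leaves descending from $x$. For $A\subseteq V$, sets $X,W\subseteq A$ are $1$-neighbour equivalent w.r.t. $A$ if $\min\{1,|X\cap N(v)|\}=\min\{1,|W\cap N(v)|\}$ for all $v\in V\setminus A$, and $\mathsf{nec}_1(A)$ is the number of equivalence classes of this relation.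
   Formalization: For a graph without edges every nec_1 is 1, all logarithms vanish and the stated bound would be O(0), which no algorithm meets; for such graphs the time bound proved is O(n^2) instead, while for every graph with an edge it is the stated sum. *)

theory Defs
  imports Complex_Main
begin

section \<open>Graphs and Subset Vertex Cover\<close>

definition simple_graph :: "'a set \<Rightarrow> 'a set set \<Rightarrow> bool" where
  "simple_graph V E \<longleftrightarrow> finite V \<and> (\<forall>e\<in>E. e \<subseteq> V \<and> card e = 2)"

definition neighbours :: "'a set set \<Rightarrow> 'a \<Rightarrow> 'a set" where
  "neighbours E v = {u. {u, v} \<in> E}"

definition T_vertex_cover :: "'a set \<Rightarrow> 'a set set \<Rightarrow> 'a set \<Rightarrow> 'a set \<Rightarrow> bool" where
  "T_vertex_cover V E T S \<longleftrightarrow> S \<subseteq> V \<and> (\<forall>e\<in>E. e \<inter> T \<noteq> {} \<longrightarrow> e \<inter> S \<noteq> {})"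

definition subset_vertex_cover :: "'a set \<Rightarrow> 'a set set \<Rightarrow> 'a set \<Rightarrow> nat \<Rightarrow> bool" where
  "subset_vertex_cover V E T k \<longleftrightarrow> (\<exists>S. T_vertex_cover V E T S \<and> card S \<le> k)"


section \<open>Neighbour equivalence\<close>

definition nec1_rel :: "'a set \<Rightarrow> 'a set set \<Rightarrow> 'a set \<Rightarrow> ('a set \<times> 'a set) set" where
  "nec1_rel V E A = {(X, W). X \<subseteq> A \<and> W \<subseteq> A \<and>
     (\<forall>v\<in>V - A. min 1 (card (X \<inter> neighbours E v)) = min 1 (card (W \<inter> neighbours E v)))}"

definition nec1 :: "'a set \<Rightarrow> 'a set set \<Rightarrow> 'a set \<Rightarrow> nat" where
  "nec1 V E A = card (Pow A // nec1_rel V E A)"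


section \<open>Rooted layouts\<close>

text \<open>
  A rooted binary tree (every inner node has exactly two children) together with the bijection
  between the vertices and its leaves, the latter being stored as leaf labels.
\<close>

datatype 'a layout = Leaf 'a | Node "'a layout" "'a layout"

fun leaves :: "'a layout \<Rightarrow> 'a list" where
  "leaves (Leaf v) = [v]"
| "leaves (Node l r) = leaves l @ leaves r"

definition rooted_layout :: "'a set \<Rightarrow> 'a layout \<Rightarrow> bool" where
  "rooted_layout V L \<longleftrightarrow> distinct (leaves L) \<and> set (leaves L) = V"

text \<open>
  A node is identified with the subtree hanging from it. As leaf labels are distinct in a rooted
  layout, different nodes have different subtrees, so the set below has one element per node.
\<close>

fun nodes :: "'a layout \<Rightarrow> 'a layout set" where
  "nodes (Leaf v) = {Leaf v}"
| "nodes (Node l r) = insert (Node l r) (nodes l \<union> nodes r)"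

definition vertices_below :: "'a layout \<Rightarrow> 'a set" where
  "vertices_below x = set (leaves x)"

definition layout_cost :: "'a set \<Rightarrow> 'a set set \<Rightarrow> 'a layout \<Rightarrow> real" where
  "layout_cost V E L =
     (\<Sum>x\<in>nodes L. real (nec1 V E (vertices_below x)) ^ 4 * real (card V) ^ 2
                    * log 2 (real (nec1 V E (vertices_below x))))"


section \<open>A word RAM\<close>

text \<open>
  Structured programs over finitely many registers and finitely many random-access arrays (those
  named in the program). A machine word is a natural number below \<open>2 ^ w\<close>, where \<open>w\<close> is the word
  length. A program in which the value of some subexpression does not fit into a word has no
  execution at all: there is no arithmetic on large numbers at unit cost. Subtraction is truncated.
\<close>

datatype binop = Plus | Minus | Times | Div

datatype aexp = Num nat | Reg string | Elem string aexp | Bin binop aexp aexp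

datatype bexp = Less aexp aexp | Equal aexp aexp | Neg bexp | Conj bexp bexp

datatype com =
    Skip
  | Assign string aexp
  | Store string aexp aexp \<comment> \<open>array, index, value\<close>
  | Seq com com
  | If bexp com com
  | While bexp com

record state =
  reg :: "string \<Rightarrow> nat"
  arr :: "string \<Rightarrow> nat \<Rightarrow> nat"

fun binop_val :: "binop \<Rightarrow> nat \<Rightarrow> nat \<Rightarrow> nat" where
  "binop_val Plus a b = a + b"
| "binop_val Minus a b = a - b"
| "binop_val Times a b = a * b"
| "binop_val Div a b = a div b"

fun aval :: "aexp \<Rightarrow> state \<Rightarrow> nat" where
  "aval (Num m) s = m"
| "aval (Reg x) s = reg s x"
| "aval (Elem a e) s = arr s a (aval e s)"
| "aval (Bin f e1 e2) s = binop_val f (aval e1 s) (aval e2 s)"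

fun bval :: "bexp \<Rightarrow> state \<Rightarrow> bool" where
  "bval (Less e1 e2) s \<longleftrightarrow> aval e1 s < aval e2 s"
| "bval (Equal e1 e2) s \<longleftrightarrow> aval e1 s = aval e2 s"
| "bval (Neg b) s \<longleftrightarrow> \<not> bval b s"
| "bval (Conj b1 b2) s \<longleftrightarrow> bval b1 s \<and> bval b2 s"

fun afits :: "nat \<Rightarrow> aexp \<Rightarrow> state \<Rightarrow> bool" where
  "afits w (Num m) s \<longleftrightarrow> m < 2 ^ w"
| "afits w (Reg x) s \<longleftrightarrow> reg s x < 2 ^ w"
| "afits w (Elem a e) s \<longleftrightarrow> afits w e s \<and> arr s a (aval e s) < 2 ^ w"
| "afits w (Bin f e1 e2) s \<longleftrightarrow>
     afits w e1 s \<and> afits w e2 s \<and> binop_val f (aval e1 s) (aval e2 s) < 2 ^ w"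

fun bfits :: "nat \<Rightarrow> bexp \<Rightarrow> state \<Rightarrow> bool" where
  "bfits w (Less e1 e2) s \<longleftrightarrow> afits w e1 s \<and> afits w e2 s"
| "bfits w (Equal e1 e2) s \<longleftrightarrow> afits w e1 s \<and> afits w e2 s"
| "bfits w (Neg b) s \<longleftrightarrow> bfits w b s"
| "bfits w (Conj b1 b2) s \<longleftrightarrow> bfits w b1 s \<and> bfits w b2 s"

fun acost :: "aexp \<Rightarrow> nat" where
  "acost (Num m) = 1"
| "acost (Reg x) = 1"
| "acost (Elem a e) = acost e + 1"
| "acost (Bin f e1 e2) = acost e1 + acost e2 + 1"

fun bcost :: "bexp \<Rightarrow> nat" where
  "bcost (Less e1 e2) = acost e1 + acost e2 + 1"
| "bcost (Equal e1 e2) = acost e1 + acost e2 + 1"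
| "bcost (Neg b) = bcost b + 1"
| "bcost (Conj b1 b2) = bcost b1 + bcost b2 + 1"

text \<open>
  \<open>exec w c s t s'\<close>: with word length \<open>w\<close>, program \<open>c\<close> started in \<open>s\<close> halts in \<open>s'\<close> after \<open>t\<close> steps.
\<close>

inductive exec :: "nat \<Rightarrow> com \<Rightarrow> state \<Rightarrow> nat \<Rightarrow> state \<Rightarrow> bool" for w :: nat where
  Skip: "exec w Skip s 1 s"
| Assign: "afits w e s \<Longrightarrow>
    exec w (Assign x e) s (acost e + 1) (s\<lparr>reg := (reg s)(x := aval e s)\<rparr>)"
| Store: "afits w i s \<Longrightarrow> afits w e s \<Longrightarrow>
    exec w (Store a i e) s (acost i + acost e + 1)
      (s\<lparr>arr := (arr s)(a := (arr s a)(aval i s := aval e s))\<rparr>)"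
| Seq: "exec w c1 s t1 s' \<Longrightarrow> exec w c2 s' t2 s'' \<Longrightarrow> exec w (Seq c1 c2) s (t1 + t2) s''"
| IfTrue: "bfits w b s \<Longrightarrow> bval b s \<Longrightarrow> exec w c1 s t s' \<Longrightarrow>
    exec w (If b c1 c2) s (bcost b + t) s'"
| IfFalse: "bfits w b s \<Longrightarrow> \<not> bval b s \<Longrightarrow> exec w c2 s t s' \<Longrightarrow>
    exec w (If b c1 c2) s (bcost b + t) s'"
| WhileFalse: "bfits w b s \<Longrightarrow> \<not> bval b s \<Longrightarrow> exec w (While b c) s (bcost b) s"
| WhileTrue: "bfits w b s \<Longrightarrow> bval b s \<Longrightarrow> exec w c s t1 s' \<Longrightarrow> exec w (While b c) s' t2 s'' \<Longrightarrow>
    exec w (While b c) s (bcost b + t1 + t2) s''"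

lemma exec_deterministic:
  "exec w c s t s' \<Longrightarrow> exec w c s u s'' \<Longrightarrow> t = u \<and> s' = s''"
proof (induction arbitrary: u s'' rule: exec.induct)
  case (Skip s)
  then show ?case by cases auto
next
  case (Assign e s x)
  from Assign.prems show ?case by cases auto
next
  case (Store i s e a)
  from Store.prems show ?case by cases auto
next
  case (Seq c1 s t1 s1 c2 t2 s2)
  from Seq.prems show ?case by cases (use Seq.IH in blast)
next
  case (IfTrue b s c1 t s1 c2)
  from IfTrue.prems show ?case by cases (use IfTrue.hyps IfTrue.IH in blast)+
next
  case (IfFalse b s c2 t s1 c1)
  from IfFalse.prems show ?case by cases (use IfFalse.hyps IfFalse.IH in blast)+
next
  case (WhileFalse b s c)
  from WhileFalse.prems show ?case by cases (use WhileFalse.hyps in blast)+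
next
  case (WhileTrue b s c t1 s1 t2 s2)
  from WhileTrue.prems show ?case by cases (use WhileTrue.hyps WhileTrue.IH in blast)+
qed


section \<open>Encoding of instances\<close>

text \<open>
  Postfix (postorder) notation of a layout: \<open>v + 1\<close> stands for the leaf of vertex \<open>v\<close>, and \<open>0\<close> for
  an inner node whose two subtrees precede it. Pointer structures and this notation can be
  converted into each other in linear time.
\<close>

fun postfix :: "nat layout \<Rightarrow> nat list" where
  "postfix (Leaf v) = [v + 1]"
| "postfix (Node l r) = postfix l @ postfix r @ [0]"

text \<open>
  The graph has vertex set \<open>{..<n}\<close> and is given by its adjacency matrix, stored row by row, and
  \<open>T\<close> by its characteristic vector. All other registers and array cells are initially zero.
\<close>

definition instance_state ::
  "nat \<Rightarrow> nat set set \<Rightarrow> nat layout \<Rightarrow> nat set \<Rightarrow> nat \<Rightarrow> state" where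
  "instance_state n E L T k =
     \<lparr>reg = (\<lambda>_. 0)(''n'' := n, ''k'' := k),
      arr = (\<lambda>_ _. 0)(
        ''adj'' := (\<lambda>i. of_bool (i < n * n \<and> {i div n, i mod n} \<in> E)),
        ''T'' := (\<lambda>i. of_bool (i < n \<and> i \<in> T)),
        ''L'' := (\<lambda>i. if i < length (postfix L) then postfix L ! i else 0))\<rparr>"

text \<open>
  Word lengths \<open>w\<close> logarithmic in \<open>n\<close> and the number of equivalence classes, as needed to
  address tables indexed by these classes.
\<close>

definition sufficient_word_length ::
  "real \<Rightarrow> 'a set \<Rightarrow> 'a set set \<Rightarrow> 'a layout \<Rightarrow> nat \<Rightarrow> bool" where
  "sufficient_word_length d V E L w \<longleftrightarrow>
     real w \<ge> d * log 2 (real (card V) + (\<Sum>x\<in>nodes L. real (nec1 V E (vertices_below x))))"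

text \<open>
  The time bound. If \<open>G\<close> has an edge it is exactly \<open>layout_cost\<close> (the leaf of an end-vertex of an
  edge has two classes, so this is at least \<open>n\<^sup>2\<close>). If \<open>G\<close> has no edge, then there is one class at
  every node, all logarithms vanish and \<open>layout_cost\<close> is \<open>0\<close>; the time to read the adjacency
  matrix replaces it there.
\<close>

definition time_bound :: "'a set \<Rightarrow> 'a set set \<Rightarrow> 'a layout \<Rightarrow> real" where
  "time_bound V E L = (if E = {} then real (card V) ^ 2 else layout_cost V E L)"

end

theory Submission
  imports Defs
begin

text \<open>
  The complements of \<open>T\<close>-vertex covers are the sets \<open>X\<close> without edges between \<open>X \<inter> T\<close> and \<open>X\<close>, and a
  largest one is found by dynamic programming over the layout. At a node with vertex set \<open>A\<close>, how a
  partial solution \<open>X \<subseteq> A\<close> can be extended is determined by the 1-neighbour classes of \<open>X \<inter> T\<close> and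
  \<open>X\<close>, that is, by their neighbourhoods outside \<open>A\<close>. To combine the tables of two children with \<open>a\<close>
  and \<open>b\<close> classes, first compute for every pair of classes the class of the union and whether the two
  representatives are adjacent, in time \<open>n (a b)\<^sup>2\<close>; then every combination of the \<open>a\<^sup>2 b\<^sup>2\<close> pairs of
  table entries takes constant time. As \<open>(a b)\<^sup>2 \<le> a\<^sup>4 + b\<^sup>4\<close>, this cost can be charged to the children.
  Per node only a factor \<open>n\<close> is spent, so that the nodes with a single class, for which the
  logarithm in the bound vanishes, contribute \<open>n\<^sup>2\<close> in total, which is paid by one end-vertex of an edge.
\<close>


section \<open>Reasoning about programs\<close>

text \<open>Two classes per partial solution are needed because an edge leaving \<open>A\<close> is
  forbidden in two ways: an end in \<open>X \<inter> T\<close> excludes every neighbour outside, an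
  end in \<open>X - T\<close> only excludes neighbours in \<open>T\<close>. The class of a union
  depends only on the classes of its parts, so at a node only the \<open>a * b\<close> unions of the
  children's representatives have to be tried. Each is compared with the rows found so far by plain
  linear search, at about \<open>n\<close> steps per row; this is no dearer than the bound for
  combining tables, so the logarithm is pure slack wherever there are at least two classes. The
  delicate point is overflow: a program with a subexpression exceeding a word has no execution.
  Hence the number of classes must be bounded by \<open>nec1\<close> while they are still being
  found, and all addresses are polynomials of fixed degree in one common bound \<open>K\<close>.
  Since cells start as zero and unwritten cells cost nothing, zero gets a meaning: no partial
  solution in a table, and the empty representative in the first row of a leaf.\<close>

definition runs :: "nat \<Rightarrow> com \<Rightarrow> state \<Rightarrow> nat \<Rightarrow> (state \<Rightarrow> bool) \<Rightarrow> bool" where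
  "runs w c s B Q \<longleftrightarrow> (\<exists>t s'. exec w c s t s' \<and> t \<le> B \<and> Q s')"

fun written_regs :: "com \<Rightarrow> string set" where
  "written_regs Skip = {}"
| "written_regs (Assign x e) = {x}"
| "written_regs (Store a i e) = {}"
| "written_regs (Seq c1 c2) = written_regs c1 \<union> written_regs c2"
| "written_regs (If b c1 c2) = written_regs c1 \<union> written_regs c2"
| "written_regs (While b c) = written_regs c"

fun written_arrs :: "com \<Rightarrow> string set" where
  "written_arrs Skip = {}"
| "written_arrs (Assign x e) = {}"
| "written_arrs (Store a i e) = {a}"
| "written_arrs (Seq c1 c2) = written_arrs c1 \<union> written_arrs c2"
| "written_arrs (If b c1 c2) = written_arrs c1 \<union> written_arrs c2"
| "written_arrs (While b c) = written_arrs c"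

definition frame :: "string set \<Rightarrow> string set \<Rightarrow> state \<Rightarrow> state \<Rightarrow> bool" where
  "frame X A s s' \<longleftrightarrow> (\<forall>x. x \<notin> X \<longrightarrow> reg s' x = reg s x) \<and> (\<forall>a. a \<notin> A \<longrightarrow> arr s' a = arr s a)"

lemma frame_refl: "frame X A s s"
  by (simp add: frame_def)

lemma frame_trans: "frame X A s s' \<Longrightarrow> frame X A s' s'' \<Longrightarrow> frame X A s s''"
  by (simp add: frame_def)

lemma frame_mono: "frame X A s s' \<Longrightarrow> X \<subseteq> X' \<Longrightarrow> A \<subseteq> A' \<Longrightarrow> frame X' A' s s'"
  unfolding frame_def by blast

lemma frame_reg: "frame X A s s' \<Longrightarrow> x \<notin> X \<Longrightarrow> reg s' x = reg s x"
  and frame_arr: "frame X A s s' \<Longrightarrow> a \<notin> A \<Longrightarrow> arr s' a = arr s a"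
  by (simp_all add: frame_def)

lemma exec_frame: "exec w c s t s' \<Longrightarrow> frame (written_regs c) (written_arrs c) s s'"
proof (induction rule: exec.induct)
  case (Seq c1 s t1 s' c2 t2 s'')
  then show ?case by (auto simp: frame_def)
next
  case (WhileTrue b s c t1 s' t2 s'')
  then show ?case by (auto simp: frame_def)
qed (auto simp: frame_def)

text \<open>The syntactic frame of \<open>c\<close> is handed to the new postcondition for free, so
  specifications of subprograms only state what changes.\<close>

lemma runs_mono:
  assumes "runs w c s B Q" and "B \<le> B'"
    and "\<And>s'. Q s' \<Longrightarrow> frame (written_regs c) (written_arrs c) s s' \<Longrightarrow> Q' s'"
  shows "runs w c s B' Q'"
  using assms exec_frame unfolding runs_def by (meson le_trans)

text \<open>The postcondition of \<open>c1\<close> is itself a claim about running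
  \<open>c2\<close>. This continuation form is what later allows the main loop to be unrolled along
  the layout.\<close>

lemma runs_seq:
  assumes "runs w c1 s B1 (\<lambda>s'. runs w c2 s' B2 Q)" and "B1 + B2 \<le> B"
  shows "runs w (Seq c1 c2) s B Q"
proof -
  obtain t s' t' s'' where "exec w c1 s t s'" "t \<le> B1" "exec w c2 s' t' s''" "t' \<le> B2" "Q s''"
    using assms(1) unfolding runs_def by blast
  then show ?thesis
    unfolding runs_def using assms(2) exec.Seq by (intro exI[of _ "t + t'"] exI[of _ s'']) auto
qed

lemma runs_seq_frame:
  assumes "runs w c1 s B1 Q1" and "B1 + B2 \<le> B"
    and "\<And>s'. Q1 s' \<Longrightarrow> frame (written_regs c1) (written_arrs c1) s s' \<Longrightarrow> runs w c2 s' B2 Q"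
  shows "runs w (Seq c1 c2) s B Q"
  by (rule runs_seq[OF runs_mono[OF assms(1) order_refl assms(3)] assms(2)])

lemma runs_while_true:
  assumes "bfits w b s" "bval b s" and "runs w c s B1 (\<lambda>s'. runs w (While b c) s' B2 Q)"
    and "bcost b + B1 + B2 \<le> B"
  shows "runs w (While b c) s B Q"
proof -
  obtain t s' t' s'' where "exec w c s t s'" "t \<le> B1" "exec w (While b c) s' t' s''" "t' \<le> B2" "Q s''"
    using assms(3) unfolding runs_def by blast
  then show ?thesis
    unfolding runs_def using assms exec.WhileTrue
    by (intro exI[of _ "bcost b + t + t'"] exI[of _ s'']) auto
qed

lemma runs_while_false:
  "bfits w b s \<Longrightarrow> \<not> bval b s \<Longrightarrow> Q s \<Longrightarrow> bcost b \<le> B \<Longrightarrow> runs w (While b c) s B Q"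
  unfolding runs_def using exec.WhileFalse by blast

lemma runs_if:
  assumes "bfits w b s" "bval b s \<Longrightarrow> runs w c1 s B1 Q" "\<not> bval b s \<Longrightarrow> runs w c2 s B1 Q"
    and "bcost b + B1 \<le> B"
  shows "runs w (If b c1 c2) s B Q"
proof (cases "bval b s")
  case True
  with assms(2) obtain t s' where "exec w c1 s t s'" "t \<le> B1" "Q s'" unfolding runs_def by blast
  with True assms(1,4) show ?thesis
    unfolding runs_def by (intro exI[of _ "bcost b + t"] exI[of _ s']) (auto intro: exec.IfTrue)
next
  case False
  with assms(3) obtain t s' where "exec w c2 s t s'" "t \<le> B1" "Q s'" unfolding runs_def by blast
  with False assms(1,4) show ?thesis
    unfolding runs_def by (intro exI[of _ "bcost b + t"] exI[of _ s']) (auto intro: exec.IfFalse)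
qed

text \<open>
  \<open>wp\<close> and \<open>max_cost\<close> are meant for loop-free programs; on loops they take the junk values
  \<open>False\<close> and \<open>0\<close>.
\<close>

fun wp :: "nat \<Rightarrow> com \<Rightarrow> (state \<Rightarrow> bool) \<Rightarrow> state \<Rightarrow> bool" where
  "wp w Skip Q s = Q s"
| "wp w (Assign x e) Q s = (afits w e s \<and> Q (s\<lparr>reg := (reg s)(x := aval e s)\<rparr>))"
| "wp w (Store a i e) Q s = (afits w i s \<and> afits w e s \<and>
     Q (s\<lparr>arr := (arr s)(a := (arr s a)(aval i s := aval e s))\<rparr>))"
| "wp w (Seq c1 c2) Q s = wp w c1 (wp w c2 Q) s"
| "wp w (If b c1 c2) Q s = (bfits w b s \<and> (if bval b s then wp w c1 Q s else wp w c2 Q s))"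
| "wp w (While b c) Q s = False"

fun max_cost :: "com \<Rightarrow> nat" where
  "max_cost Skip = 1"
| "max_cost (Assign x e) = acost e + 1"
| "max_cost (Store a i e) = acost i + acost e + 1"
| "max_cost (Seq c1 c2) = max_cost c1 + max_cost c2"
| "max_cost (If b c1 c2) = bcost b + max (max_cost c1) (max_cost c2)"
| "max_cost (While b c) = 0"

lemma runs_max_cost: "wp w c Q s \<Longrightarrow> runs w c s (max_cost c) Q"
proof (induction c arbitrary: Q s)
  case Skip
  then show ?case unfolding runs_def using exec.Skip by force
next
  case (Assign x e)
  then show ?case unfolding runs_def using exec.Assign by force
next
  case (Store a i e)
  then show ?case unfolding runs_def using exec.Store by force
next
  case (Seq c1 c2)
  have "runs w c1 s (max_cost c1) (\<lambda>s'. runs w c2 s' (max_cost c2) Q)"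
    by (rule runs_mono[OF Seq.IH(1)[of "wp w c2 Q"]]) (use Seq in auto)
  then show ?case by (rule runs_seq) simp
next
  case (If b c1 c2)
  show ?case
    by (rule runs_if[where ?B1.0 = "max (max_cost c1) (max_cost c2)"])
      (use If in \<open>auto split: if_splits intro: runs_mono[OF If.IH(1)] runs_mono[OF If.IH(2)]\<close>)
qed simp

lemma runs_wp: "max_cost c \<le> B \<Longrightarrow> wp w c Q s \<Longrightarrow> runs w c s B Q"
  using runs_max_cost runs_mono by blast

section \<open>Counting loops\<close>

definition For :: "string \<Rightarrow> string \<Rightarrow> com \<Rightarrow> com" where
  "For x y c = Seq (Assign x (Num 0))
     (While (Less (Reg x) (Reg y)) (Seq c (Assign x (Bin Plus (Reg x) (Num 1)))))"

lemma written_For [simp]: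
  "written_regs (For x y c) = insert x (written_regs c)"
  "written_arrs (For x y c) = written_arrs c"
  by (auto simp: For_def)

text \<open>The increment comes after the body has established \<open>I (Suc k)\<close>, so
  \<open>inv_x\<close> demands that \<open>I\<close> ignores the counter, whose value is passed to
  \<open>step\<close> separately. In the budget, 5 is the initial assignment (2) plus the failing
  last test (3), and 7 is a successful test (3) plus the increment (4).\<close>

lemma runs_For:
  assumes "x \<noteq> y" "x \<notin> written_regs c" "y \<notin> written_regs c" "h < 2 ^ w" "reg s y = h"
    and inv_x: "\<And>k s v. I k (s\<lparr>reg := (reg s)(x := v)\<rparr>) = I k s"
    and init: "I 0 s"
    and step: "\<And>k s1. k < h \<Longrightarrow> I k s1 \<Longrightarrow> reg s1 x = k \<Longrightarrow>
      frame (insert x (written_regs c)) (written_arrs c) s s1 \<Longrightarrow> runs w c s1 tb (I (Suc k))"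
    and fin: "\<And>s1. I h s1 \<Longrightarrow> reg s1 x = h \<Longrightarrow>
      frame (insert x (written_regs c)) (written_arrs c) s s1 \<Longrightarrow> Q s1"
    and B: "5 + h * (tb + 7) \<le> B"
  shows "runs w (For x y c) s B Q"
proof -
  let ?fr = "\<lambda>s1. frame (insert x (written_regs c)) (written_arrs c) s s1"
  let ?W = "While (Less (Reg x) (Reg y)) (Seq c (Assign x (Bin Plus (Reg x) (Num 1))))"
  have loop: "runs w ?W s1 (3 + (h - k) * (tb + 7)) Q"
    if "k \<le> h" "I k s1" "reg s1 x = k" "?fr s1" for k s1
    using that
  proof (induction "h - k" arbitrary: k s1)
    case 0
    then show ?case using assms
      by (intro runs_while_false) (auto simp: frame_reg)
  next
    case (Suc d)
    then have k: "k < h" by simp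
    have y: "reg s1 y = h" using Suc.prems(4) assms by (simp add: frame_reg)
    let ?B = "3 + (h - Suc k) * (tb + 7)"
    have 1: "runs w c s1 tb
      (\<lambda>s'. runs w (Assign x (Bin Plus (Reg x) (Num 1))) s' 4 (\<lambda>s'. runs w ?W s' ?B Q))"
    proof (rule runs_mono[OF step[OF k Suc.prems(2-4)] order_refl])
      fix s2 assume I: "I (Suc k) s2" and f: "frame (written_regs c) (written_arrs c) s1 s2"
      have x2: "reg s2 x = k" using f assms(2) Suc.prems(3) by (simp add: frame_reg)
      have f2: "?fr s2"
        using f Suc.prems(4) by (meson frame_mono frame_trans order_refl subset_insertI)
      have "runs w ?W (s2\<lparr>reg := (reg s2)(x := Suc k)\<rparr>) ?B Q"
        by (rule Suc.hyps(1)) (use Suc.hyps(2) k I f2 in \<open>auto simp: inv_x frame_def\<close>)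
      then have "wp w (Assign x (Bin Plus (Reg x) (Num 1))) (\<lambda>s'. runs w ?W s' ?B Q) s2"
        using x2 k assms(4) by auto
      then show "runs w (Assign x (Bin Plus (Reg x) (Num 1))) s2 4 (\<lambda>s'. runs w ?W s' ?B Q)"
        by (intro runs_wp) auto
    qed
    have hk: "h - k = Suc (h - Suc k)" using k by simp
    have "runs w (Seq c (Assign x (Bin Plus (Reg x) (Num 1)))) s1 (tb + 4) (\<lambda>s'. runs w ?W s' ?B Q)"
      by (rule runs_seq[OF 1]) simp
    then show ?case
      using k y Suc.prems(3) assms(4)
      by (intro runs_while_true) (auto simp: hk)
  qed
  have "runs w (Assign x (Num 0)) s 2 (\<lambda>s'. runs w ?W s' (3 + h * (tb + 7)) Q)"
    using init inv_x loop[of 0] by (intro runs_wp) (auto simp: frame_def)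
  then show ?thesis
    unfolding For_def by (rule runs_seq) (use B in simp)
qed

text \<open>The invariant is indexed by the set of visited pairs instead of two counters, so that no
  order of visits appears in it and products of index sets can be used for deeper nesting. The 12 is
  the fixed cost 5 of the inner loop plus the overhead 7 of an outer round.\<close>

lemma runs_For2:
  assumes ne: "x \<noteq> hx" "y \<noteq> hy" "x \<noteq> y" "x \<noteq> hy" "y \<noteq> hx" "{x, hx, y, hy} \<inter> written_regs c = {}"
    and h: "a < 2 ^ w" "b < 2 ^ w" "reg s hx = a" "reg s hy = b"
    and inv_x: "\<And>D s v. Inv D (s\<lparr>reg := (reg s)(x := v)\<rparr>) = Inv D s"
    and inv_y: "\<And>D s v. Inv D (s\<lparr>reg := (reg s)(y := v)\<rparr>) = Inv D s"
    and init: "Inv {} s"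
    and step: "\<And>i j D s1. i < a \<Longrightarrow> j < b \<Longrightarrow> (i, j) \<notin> D \<Longrightarrow> D \<subseteq> {..<a} \<times> {..<b} \<Longrightarrow>
      Inv D s1 \<Longrightarrow> reg s1 x = i \<Longrightarrow> reg s1 y = j \<Longrightarrow>
      frame (insert x (insert y (written_regs c))) (written_arrs c) s s1 \<Longrightarrow>
      runs w c s1 tb (Inv (insert (i, j) D))"
    and fin: "\<And>s1. Inv ({..<a} \<times> {..<b}) s1 \<Longrightarrow>
      frame (insert x (insert y (written_regs c))) (written_arrs c) s s1 \<Longrightarrow> Q s1"
    and B: "5 + a * (b * (tb + 7) + 12) \<le> B"
  shows "runs w (For x hx (For y hy c)) s B Q"
proof (rule runs_For[where I = "\<lambda>k. Inv ({..<k} \<times> {..<b})" and h = a and tb = "5 + b * (tb + 7)"])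
  fix k s1
  assume k: "k < a" and I: "Inv ({..<k} \<times> {..<b}) s1" and x: "reg s1 x = k"
    and f1: "frame (insert x (written_regs (For y hy c))) (written_arrs (For y hy c)) s s1"
  show "runs w (For y hy c) s1 (5 + b * (tb + 7)) (Inv ({..<Suc k} \<times> {..<b}))"
  proof (rule runs_For[where I = "\<lambda>k'. Inv ({..<k} \<times> {..<b} \<union> {k} \<times> {..<k'})" and h = b and tb = tb])
    fix k' s2
    assume k': "k' < b" and I': "Inv ({..<k} \<times> {..<b} \<union> {k} \<times> {..<k'}) s2" "reg s2 y = k'"
      and f2: "frame (insert y (written_regs c)) (written_arrs c) s1 s2"
    have "reg s2 x = k" using f2 ne x by (simp add: frame_reg)
    moreover have "frame (insert x (insert y (written_regs c))) (written_arrs c) s s2"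
      using f1 f2 by (auto simp: frame_def)
    ultimately have "runs w c s2 tb (Inv (insert (k, k') ({..<k} \<times> {..<b} \<union> {k} \<times> {..<k'})))"
      using k k' I' by (intro step) auto
    moreover have "insert (k, k') ({..<k} \<times> {..<b} \<union> {k} \<times> {..<k'}) = {..<k} \<times> {..<b} \<union> {k} \<times> {..<Suc k'}"
      by auto
    ultimately show "runs w c s2 tb (Inv ({..<k} \<times> {..<b} \<union> {k} \<times> {..<Suc k'}))"
      by simp
  next
    fix s2 assume "Inv ({..<k} \<times> {..<b} \<union> {k} \<times> {..<b}) s2"
    moreover have "{..<k} \<times> {..<b} \<union> {k} \<times> {..<b} = {..<Suc k} \<times> {..<b}" by auto
    ultimately show "Inv ({..<Suc k} \<times> {..<b}) s2" by simp
  next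
    show "reg s1 hy = b" using f1 ne h by (simp add: frame_reg)
  qed (use ne h inv_y I in auto)
next
  have "(5 + b * (tb + 7)) + 7 = b * (tb + 7) + 12" by simp
  then show "5 + a * (5 + b * (tb + 7) + 7) \<le> B" using B by metis
qed (use ne h inv_x init fin in auto)

section \<open>Addresses\<close>

text \<open>
  Arrays are infinite and unwritten cells cost nothing, so multi-dimensional tables are addressed
  through an injective polynomial instead of being packed.
\<close>

definition pair :: "nat \<Rightarrow> nat \<Rightarrow> nat" where
  "pair x y = (x + y) * (x + y) + y"

abbreviation triple :: "nat \<Rightarrow> nat \<Rightarrow> nat \<Rightarrow> nat" where
  "triple x y z \<equiv> pair (pair x y) z"

text \<open>For \<open>d = x + y\<close> the value lies between \<open>d * d\<close> and
  \<open>d * d + d\<close>, hence below the next square. So \<open>d\<close> can be recovered, and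
  then \<open>y\<close> as the remainder.\<close>

lemma pair_eq_iff [simp]: "pair x y = pair x' y' \<longleftrightarrow> x = x' \<and> y = y'"
proof
  assume eq: "pair x y = pair x' y'"
  have less: "pair a b < pair a' b'" if "a + b < a' + b'" for a b a' b' :: nat
  proof -
    have "pair a b < (a + b + 1) * (a + b + 1)" by (simp add: pair_def algebra_simps)
    also have "\<dots> \<le> (a' + b') * (a' + b')" using that by (intro mult_mono) auto
    also have "\<dots> \<le> pair a' b'" by (simp add: pair_def)
    finally show ?thesis .
  qed
  have "x + y = x' + y'" using eq less[of x y x' y'] less[of x' y' x y] by linarith
  with eq show "x = x' \<and> y = y'" by (auto simp: pair_def)
qed simp

definition pair_exp :: "aexp \<Rightarrow> aexp \<Rightarrow> aexp" where
  "pair_exp e f = Bin Plus (Bin Times (Bin Plus e f) (Bin Plus e f)) f"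

abbreviation triple_exp :: "string \<Rightarrow> string \<Rightarrow> string \<Rightarrow> aexp" where
  "triple_exp x y z \<equiv> pair_exp (pair_exp (Reg x) (Reg y)) (Reg z)"

lemma aval_pair_exp [simp]: "aval (pair_exp e f) s = pair (aval e s) (aval f s)"
  by (simp add: pair_exp_def pair_def)

lemma acost_pair_exp [simp]: "acost (pair_exp e f) = 2 * acost e + 3 * acost f + 4"
  by (simp add: pair_exp_def)

text \<open>The intermediate values \<open>x + y\<close> and its square never exceed the final
  value, so the overflow check reduces to the address itself.\<close>

lemma afits_pair_exp [simp]:
  "afits w (pair_exp e f) s \<longleftrightarrow>
     afits w e s \<and> afits w f s \<and> pair (aval e s) (aval f s) < 2 ^ w"
proof -
  have "x + y \<le> pair x y" "(x + y) * (x + y) \<le> pair x y" for x y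
    unfolding pair_def by (cases "x + y"; auto)+
  then show ?thesis
    by (auto simp: pair_exp_def simp flip: pair_def intro: le_less_trans)
      (simp_all add: pair_def)
qed

lemma pair_le: "x \<le> K \<Longrightarrow> y \<le> K \<Longrightarrow> pair x y \<le> 5 * K ^ 2"
proof -
  assume "x \<le> K" "y \<le> K"
  then have "pair x y \<le> (K + K) * (K + K) + K" unfolding pair_def by (intro add_mono mult_mono) auto
  also have "\<dots> \<le> 5 * K ^ 2" using le_square[of K] by (simp add: power2_eq_square algebra_simps)
  finally show ?thesis .
qed

text \<open>Applying \<open>pair_le\<close> with \<open>5 * K ^ 2\<close> in place of
  \<open>K\<close> gives \<open>5 * (5 * K ^ 2) ^ 2\<close>, the origin of the constant 125
  throughout.\<close>

lemma triple_le: "x \<le> K \<Longrightarrow> y \<le> K \<Longrightarrow> z \<le> K \<Longrightarrow> triple x y z \<le> 125 * K ^ 4"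
proof -
  assume "x \<le> K" "y \<le> K" "z \<le> K"
  moreover have "K \<le> 5 * K ^ 2" using le_square[of K] by (simp add: power2_eq_square)
  ultimately have "triple x y z \<le> 5 * (5 * K ^ 2) ^ 2" by (intro pair_le[of _ "5 * K ^ 2"]) (auto intro: pair_le)
  then show ?thesis by (simp add: power2_eq_square power4_eq_xxxx)
qed


section \<open>Partial solutions\<close>

definition boundary :: "'a set \<Rightarrow> 'a set set \<Rightarrow> 'a set \<Rightarrow> 'a set \<Rightarrow> 'a set" where
  "boundary V E A X = {v \<in> V - A. \<exists>u\<in>X. {u, v} \<in> E}"

definition no_edge :: "'a set set \<Rightarrow> 'a set \<Rightarrow> 'a set \<Rightarrow> bool" where
  "no_edge E X Y \<longleftrightarrow> (\<forall>u\<in>X. \<forall>v\<in>Y. {u, v} \<notin> E)"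

text \<open>
  A single bit per vertex suffices to store a representative and its boundary: membership in \<open>X\<close>
  inside \<open>A\<close>, adjacency to \<open>X\<close> outside.
\<close>

definition code :: "'a set set \<Rightarrow> 'a set \<Rightarrow> 'a set \<Rightarrow> 'a \<Rightarrow> bool" where
  "code E A X v \<longleftrightarrow> (if v \<in> A then v \<in> X else \<exists>u\<in>X. {u, v} \<in> E)"

lemma card_quotient_kernel:
  "card (S // {(x, y). x \<in> S \<and> y \<in> S \<and> f x = f y}) = card (f ` S)"
proof -
  let ?r = "{(x, y). x \<in> S \<and> y \<in> S \<and> f x = f y}"
  have "S // ?r = (\<lambda>c. {y \<in> S. f y = c}) ` (f ` S)"
  proof -
    have "?r `` {x} = {y \<in> S. f y = f x}" if "x \<in> S" for x using that by auto
    then show ?thesis by (simp add: quotient_def image_image UNION_singleton_eq_range cong: image_cong)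
  qed
  moreover have "inj_on (\<lambda>c. {y \<in> S. f y = c}) (f ` S)"
    by (rule inj_onI) blast
  ultimately show ?thesis by (simp add: card_image)
qed

text \<open>Truncating at 1 only leaves whether \<open>v\<close> has a neighbour in
  \<open>X\<close>, so equivalence means equal boundaries. Finiteness matters: an infinite
  intersection would have cardinality 0 and look empty.\<close>

lemma nec1_eq_card_boundary:
  assumes "finite V" "A \<subseteq> V"
  shows "nec1 V E A = card (boundary V E A ` Pow A)"
proof -
  have min_card: "min 1 (card (X \<inter> neighbours E v)) = of_bool (\<exists>u\<in>X. {u, v} \<in> E)" if "X \<subseteq> A" for X v
  proof -
    have "finite (X \<inter> neighbours E v)"
      using finite_subset[OF that finite_subset[OF assms(2,1)]] by simp
    moreover have "X \<inter> neighbours E v = {} \<longleftrightarrow> \<not> (\<exists>u\<in>X. {u, v} \<in> E)"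
      unfolding neighbours_def by blast
    moreover have "min 1 m = of_bool (m \<noteq> 0)" for m :: nat by (cases m) auto
    ultimately show ?thesis by (simp only: card_eq_0_iff) auto
  qed
  have "nec1_rel V E A = {(X, W). X \<in> Pow A \<and> W \<in> Pow A \<and> boundary V E A X = boundary V E A W}"
  proof -
    have "(\<forall>v\<in>V - A. min 1 (card (X \<inter> neighbours E v)) = min 1 (card (W \<inter> neighbours E v))) \<longleftrightarrow>
        boundary V E A X = boundary V E A W" if "X \<subseteq> A" "W \<subseteq> A" for X W
      unfolding min_card[OF that(1)] min_card[OF that(2)] of_bool_eq_iff boundary_def by blast
    then show ?thesis unfolding nec1_rel_def by blast
  qed
  then show ?thesis unfolding nec1_def using card_quotient_kernel[of "Pow A" "boundary V E A"] by simp
qed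

text \<open>Serves in two ways: explicit inequivalent sets give lower bounds on \<open>nec1\<close>,
  and the rows stored by the program at an inner node, being pairwise inequivalent, can never
  outnumber the classes.\<close>

lemma card_le_nec1:
  assumes "finite V" "A \<subseteq> V" "\<And>i. i < m \<Longrightarrow> R i \<subseteq> A" "inj_on (\<lambda>i. boundary V E A (R i)) {..<m}"
  shows "m \<le> nec1 V E A"
proof -
  have "finite (boundary V E A ` Pow A)" using assms finite_subset by blast
  then have "card ((\<lambda>i. boundary V E A (R i)) ` {..<m}) \<le> card (boundary V E A ` Pow A)"
    using assms(3) by (intro card_mono) auto
  then show ?thesis using assms by (simp add: card_image nec1_eq_card_boundary)
qed

lemma nec1_ge_1: "finite V \<Longrightarrow> A \<subseteq> V \<Longrightarrow> 1 \<le> nec1 V E A"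
  by (rule card_le_nec1[where R = "\<lambda>_. {}"]) (auto simp: lessThan_Suc)

lemma no_edge_sym: "no_edge E X Y \<Longrightarrow> no_edge E Y X"
  unfolding no_edge_def by (metis insert_commute)

lemma no_edge_mono: "no_edge E X Y \<Longrightarrow> X' \<subseteq> X \<Longrightarrow> Y' \<subseteq> Y \<Longrightarrow> no_edge E X' Y'"
  unfolding no_edge_def by blast

text \<open>A set inside \<open>B\<close> lies outside \<open>A\<close>, so it is adjacent to
  \<open>X\<close> iff it meets the boundary of \<open>X\<close>; thus \<open>X\<close> may be
  replaced by an equivalent set. By symmetry the other side is replaced next.\<close>

lemma no_edge_cong:
  assumes "A \<subseteq> V" "B \<subseteq> V" "A \<inter> B = {}" "X \<subseteq> A" "X' \<subseteq> A" "Y \<subseteq> B" "Y' \<subseteq> B"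
    and "boundary V E A X = boundary V E A X'" "boundary V E B Y = boundary V E B Y'"
  shows "no_edge E X Y \<longleftrightarrow> no_edge E X' Y'"
proof -
  have boundary: "no_edge E X Y \<longleftrightarrow> boundary V E A X \<inter> Y = {}"
    if "A \<subseteq> V" "B \<subseteq> V" "A \<inter> B = {}" "Y \<subseteq> B" for X Y A B
    using that unfolding no_edge_def boundary_def by blast
  have "no_edge E X Y \<longleftrightarrow> no_edge E X' Y" using assms boundary[of A B Y] by metis
  also have "\<dots> \<longleftrightarrow> no_edge E Y X'" using no_edge_sym by blast
  also have "\<dots> \<longleftrightarrow> no_edge E Y' X'" using assms boundary[of B A X'] by (metis inf_commute)
  also have "\<dots> \<longleftrightarrow> no_edge E X' Y'" using no_edge_sym by blast
  finally show ?thesis .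
qed

text \<open>A vertex outside \<open>A \<union> B\<close> is outside both parts and sees the union
  iff it lies in one of the two boundaries. This is why unions of stored representatives suffice at
  the parent.\<close>

lemma boundary_union_cong:
  "boundary V E A X = boundary V E A X' \<Longrightarrow> boundary V E B Y = boundary V E B Y' \<Longrightarrow>
   boundary V E (A \<union> B) (X \<union> Y) = boundary V E (A \<union> B) (X' \<union> Y')"
  unfolding boundary_def by blast

text \<open>The case distinction is exactly the one made by \<open>row_step\<close>: the row of a
  union is computed bit by bit from the two rows, without consulting the graph.\<close>

lemma code_union:
  assumes "A \<inter> B = {}" "X \<subseteq> A" "Y \<subseteq> B"
  shows "code E (A \<union> B) (X \<union> Y) v \<longleftrightarrow>
    (if v \<in> B then code E B Y v else if v \<in> A then code E A X v else code E A X v \<or> code E B Y v)"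
  using assms unfolding code_def by auto

text \<open>On \<open>B\<close>, the bit of \<open>X\<close> means adjacency and the bit of
  \<open>Y\<close> means membership. So the pass that forms the union also detects an edge between
  the two sets.\<close>

lemma code_conflict:
  assumes "A \<inter> B = {}" "Y \<subseteq> B"
  shows "(\<exists>v\<in>B. code E A X v \<and> code E B Y v) \<longleftrightarrow> \<not> no_edge E X Y"
proof -
  have "code E A X v \<longleftrightarrow> (\<exists>u\<in>X. {u, v} \<in> E)" if "v \<in> B" for v
    using that assms(1) by (auto simp: code_def)
  then show ?thesis using assms(2) by (auto simp: code_def no_edge_def)
qed

lemma boundary_eq_iff_code:
  "boundary V E A X = boundary V E A Y \<longleftrightarrow> (\<forall>v\<in>V - A. code E A X v = code E A Y v)"
  unfolding boundary_def code_def by auto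

text \<open>
  The constraints between a partial solution \<open>X\<close> at \<open>A\<close> and the rest of the graph only depend on
  the classes of \<open>X \<inter> T\<close> and \<open>X\<close>.
\<close>

definition realises ::
  "'a set \<Rightarrow> 'a set set \<Rightarrow> 'a set \<Rightarrow> 'a set \<Rightarrow> 'a set \<Rightarrow> 'a set \<Rightarrow> 'a set \<Rightarrow> bool" where
  "realises V E T A X P Q \<longleftrightarrow> X \<subseteq> A \<and> no_edge E (X \<inter> T) X \<and>
     boundary V E A (X \<inter> T) = boundary V E A P \<and> boundary V E A X = boundary V E A Q"

lemma realises_cong:
  "boundary V E A P = boundary V E A P' \<Longrightarrow> boundary V E A Q = boundary V E A Q' \<Longrightarrow>
   realises V E T A X P Q \<longleftrightarrow> realises V E T A X P' Q'"
  by (simp add: realises_def)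

text \<open>Only crossing edges are new. Those at \<open>X \<inter> T\<close> are decided by the
  classes \<open>P\<close> and \<open>Q'\<close>, those at \<open>Y \<inter> T\<close> by
  \<open>Q\<close> and \<open>P'\<close>; edges inside \<open>X\<close> or inside \<open>Y\<close>
  are covered by the two given partial solutions.\<close>

lemma realises_union:
  assumes AB: "A \<subseteq> V" "B \<subseteq> V" "A \<inter> B = {}"
    and sub: "P \<subseteq> A" "Q \<subseteq> A" "P' \<subseteq> B" "Q' \<subseteq> B"
    and X: "realises V E T A X P Q" and Y: "realises V E T B Y P' Q'"
    and ne: "no_edge E P Q'" "no_edge E Q P'"
  shows "realises V E T (A \<union> B) (X \<union> Y) (P \<union> P') (Q \<union> Q')"
proof -
  have "no_edge E (X \<inter> T) Y"
    using no_edge_cong[OF AB, of "X \<inter> T" P Y Q'] X Y sub ne unfolding realises_def by blast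
  moreover have "no_edge E X (Y \<inter> T)"
    using no_edge_cong[OF AB, of X Q "Y \<inter> T" P'] X Y sub ne unfolding realises_def by blast
  then have "no_edge E (Y \<inter> T) X" by (rule no_edge_sym)
  moreover have "no_edge E (X \<inter> T) X" "no_edge E (Y \<inter> T) Y" using X Y by (auto simp: realises_def)
  ultimately have "no_edge E ((X \<union> Y) \<inter> T) (X \<union> Y)" unfolding no_edge_def by blast
  moreover have "(X \<union> Y) \<inter> T = X \<inter> T \<union> Y \<inter> T" by blast
  ultimately show ?thesis
    using X Y boundary_union_cong[of V E A] unfolding realises_def by (metis Un_mono)
qed

text \<open>
  The sets \<open>R i\<close> are representatives of the classes at a node \<open>A\<close>; \<open>F i j\<close> is one more than the
  maximum size of a partial solution of type \<open>(i, j)\<close>, and \<open>0\<close> if there is none.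
\<close>

definition sound_table ::
  "'a set \<Rightarrow> 'a set set \<Rightarrow> 'a set \<Rightarrow> 'a set \<Rightarrow> nat \<Rightarrow> (nat \<Rightarrow> 'a set) \<Rightarrow> (nat \<Rightarrow> nat \<Rightarrow> nat) \<Rightarrow> bool"
where
  "sound_table V E T A m R F \<longleftrightarrow>
     (\<forall>i<m. \<forall>j<m. 0 < F i j \<longrightarrow> (\<exists>X. realises V E T A X (R i) (R j) \<and> F i j = Suc (card X)))"

definition complete_table ::
  "'a set \<Rightarrow> 'a set set \<Rightarrow> 'a set \<Rightarrow> 'a set \<Rightarrow> nat \<Rightarrow> (nat \<Rightarrow> 'a set) \<Rightarrow> (nat \<Rightarrow> nat \<Rightarrow> nat) \<Rightarrow> bool"
where
  "complete_table V E T A m R F \<longleftrightarrow>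
     (\<forall>X\<subseteq>A. no_edge E (X \<inter> T) X \<longrightarrow>
       (\<exists>i<m. \<exists>j<m. realises V E T A X (R i) (R j) \<and> card X < F i j))"

lemma sound_table_le:
  assumes "sound_table {..<n} E T A m R F" "A \<subseteq> {..<n}" "i < m" "j < m"
  shows "F i j \<le> Suc n"
proof (cases "F i j")
  case (Suc k)
  then obtain X where "X \<subseteq> A" "F i j = Suc (card X)"
    using assms unfolding sound_table_def realises_def by (metis zero_less_Suc)
  moreover have "card X \<le> card {..<n}" using \<open>X \<subseteq> A\<close> assms(2) by (intro card_mono) auto
  ultimately show ?thesis by simp
qed simp

text \<open>A partial solution \<open>X\<close> is split into \<open>X \<inter> A\<close> and
  \<open>X \<inter> B\<close>, which are again partial solutions and hence dominated by entries of
  the children. Their representatives inherit the absence of crossing edges, so the premise on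
  \<open>F\<close> applies to this very combination. The \<open>- 1\<close> arises because both
  entries are one more than a size.\<close>

lemma complete_table_union:
  assumes AB: "A \<subseteq> V" "B \<subseteq> V" "A \<inter> B = {}" "finite V"
    and sub: "\<And>i. i < a \<Longrightarrow> RA i \<subseteq> A" "\<And>j. j < b \<Longrightarrow> RB j \<subseteq> B"
    and cA: "complete_table V E T A a RA FA" and cB: "complete_table V E T B b RB FB"
    and U: "\<And>i j. i < a \<Longrightarrow> j < b \<Longrightarrow> U i j < m \<and>
      boundary V E (A \<union> B) (R (U i j)) = boundary V E (A \<union> B) (RA i \<union> RB j)"
    and F: "\<And>i I j J. i < a \<Longrightarrow> I < a \<Longrightarrow> j < b \<Longrightarrow> J < b \<Longrightarrow> 0 < FA i I \<Longrightarrow> 0 < FB j J \<Longrightarrow>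
      no_edge E (RA i) (RB J) \<Longrightarrow> no_edge E (RA I) (RB j) \<Longrightarrow>
      FA i I + FB j J - 1 \<le> F (U i j) (U I J)"
  shows "complete_table V E T (A \<union> B) m R F"
  unfolding complete_table_def
proof (intro allI impI)
  fix X assume X: "X \<subseteq> A \<union> B" "no_edge E (X \<inter> T) X"
  have "no_edge E (X \<inter> A \<inter> T) (X \<inter> A)" "no_edge E (X \<inter> B \<inter> T) (X \<inter> B)"
    using X(2) by (auto intro: no_edge_mono)
  then obtain i I j J where i: "i < a" "I < a" and j: "j < b" "J < b"
    and XA: "realises V E T A (X \<inter> A) (RA i) (RA I)" "card (X \<inter> A) < FA i I"
    and XB: "realises V E T B (X \<inter> B) (RB j) (RB J)" "card (X \<inter> B) < FB j J"
    using cA cB unfolding complete_table_def by (meson inf_le2)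
  have "no_edge E (X \<inter> A \<inter> T) (X \<inter> B)" "no_edge E (X \<inter> B \<inter> T) (X \<inter> A)"
    using X(2) by (auto intro: no_edge_mono)
  then have "no_edge E (X \<inter> A \<inter> T) (X \<inter> B)" "no_edge E (X \<inter> A) (X \<inter> B \<inter> T)"
    by (auto intro: no_edge_sym)
  moreover have "X \<inter> A \<inter> T \<subseteq> A" "X \<inter> B \<inter> T \<subseteq> B" by auto
  ultimately have ne: "no_edge E (RA i) (RB J)" "no_edge E (RA I) (RB j)"
    using no_edge_cong[OF AB(1-3), of "X \<inter> A \<inter> T" "RA i" "X \<inter> B" "RB J"]
      no_edge_cong[OF AB(1-3), of "X \<inter> A" "RA I" "X \<inter> B \<inter> T" "RB j"] XA(1) XB(1) sub i j
    by (simp_all add: realises_def)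
  then have val: "FA i I + FB j J - 1 \<le> F (U i j) (U I J)"
    and r: "realises V E T (A \<union> B) (X \<inter> A \<union> X \<inter> B) (RA i \<union> RB j) (RA I \<union> RB J)"
    using F[OF i j _ _ ne] XA(2) XB(2)
      realises_union[OF AB(1-3) sub(1)[OF i(1)] sub(1)[OF i(2)] sub(2)[OF j(1)] sub(2)[OF j(2)] XA(1) XB(1) ne]
    by simp_all
  have XX: "X = X \<inter> A \<union> X \<inter> B" using X by blast
  have "card X = card (X \<inter> A) + card (X \<inter> B)"
    using AB by (subst XX, intro card_Un_disjoint) (auto intro: finite_subset[of _ V])
  with val XA XB have "card X < F (U i j) (U I J)" by linarith
  moreover have "realises V E T (A \<union> B) X (R (U i j)) (R (U I J))"
    using r U[of i j] U[of I J] i j XX unfolding realises_def by simp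
  ultimately show "\<exists>i<m. \<exists>j<m. realises V E T (A \<union> B) X (R i) (R j) \<and> card X < F i j"
    using U i j by blast
qed

definition leaf_rep :: "'a \<Rightarrow> nat \<Rightarrow> 'a set" where
  "leaf_rep v i = (if i = 0 then {} else {v})"

text \<open>\<open>of_bool (v \<in> T)\<close> is the index of the class of
  \<open>{v} \<inter> T\<close>. As edges have two elements there are no loops, so
  \<open>{v}\<close> is always a partial solution; the values 2 and 1 are one more than the sizes of
  \<open>{v}\<close> and the empty set.\<close>

lemma tables_leaf:
  assumes E: "\<forall>e\<in>E. card e = 2"
    and F: "\<And>i j. i < 2 \<Longrightarrow> j < 2 \<Longrightarrow>
      F i j = (if j = 1 \<and> i = of_bool (v \<in> T) then 2 else if i = 0 \<and> j = 0 then 1 else 0)"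
  shows "sound_table V E T {v} 2 (leaf_rep v) F" "complete_table V E T {v} 2 (leaf_rep v) F"
proof -
  have "{v} \<notin> E" using E by (metis One_nat_def card.empty card_insert_disjoint empty_iff finite.emptyI
        n_not_Suc_n numeral_2_eq_2)
  then have v: "realises V E T {v} {v} (leaf_rep v (of_bool (v \<in> T))) (leaf_rep v 1)"
    by (auto simp: realises_def no_edge_def leaf_rep_def)
  have empty: "realises V E T {v} {} (leaf_rep v 0) (leaf_rep v 0)"
    by (auto simp: realises_def no_edge_def leaf_rep_def)
  show "sound_table V E T {v} 2 (leaf_rep v) F"
    unfolding sound_table_def
  proof (intro allI impI)
    fix i j :: nat assume ij: "i < 2" "j < 2" "0 < F i j"
    then consider "j = 1" "i = of_bool (v \<in> T)" "F i j = 2" | "i = 0" "j = 0" "F i j = 1"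
      using F[of i j] by (auto split: if_splits)
    then show "\<exists>X. realises V E T {v} X (leaf_rep v i) (leaf_rep v j) \<and> F i j = Suc (card X)"
    proof cases
      case 1 then show ?thesis using v by (intro exI[of _ "{v}"]) auto
    next
      case 2 then show ?thesis using empty by (intro exI[of _ "{}"]) auto
    qed
  qed
  show "complete_table V E T {v} 2 (leaf_rep v) F"
    unfolding complete_table_def
  proof (intro allI impI)
    fix X assume "X \<subseteq> {v}"
    then consider "X = {v}" | "X = {}" by blast
    then show "\<exists>i<2. \<exists>j<2. realises V E T {v} X (leaf_rep v i) (leaf_rep v j) \<and> card X < F i j"
    proof cases
      case 1
      have "F (of_bool (v \<in> T)) 1 = 2" using F[of "of_bool (v \<in> T)" 1] by simp
      then show ?thesis using v 1 by (intro exI[of _ "of_bool (v \<in> T)"] conjI exI[of _ 1]) auto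
    next
      case 2
      then show ?thesis using empty F[of 0 0] by (intro exI[of _ 0] conjI) auto
    qed
  qed
qed

section \<open>Vertex covers and their complements\<close>

lemma subset_vertex_cover_iff:
  assumes G: "simple_graph V E"
  shows "subset_vertex_cover V E T k \<longleftrightarrow> (\<exists>X\<subseteq>V. no_edge E (X \<inter> T) X \<and> card V - card X \<le> k)"
proof -
  have fin: "finite V" using G by (simp add: simple_graph_def)
  have edge: "\<exists>a b. e = {a, b} \<and> a \<in> V \<and> b \<in> V" if "e \<in> E" for e
    using G that unfolding simple_graph_def by (metis card_2_iff insert_subset)
  have compl: "T_vertex_cover V E T (V - X) \<longleftrightarrow> no_edge E (X \<inter> T) X" if "X \<subseteq> V" for X
  proof
    assume c: "T_vertex_cover V E T (V - X)"
    show "no_edge E (X \<inter> T) X" unfolding no_edge_def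
    proof (intro ballI notI)
      fix u v assume "u \<in> X \<inter> T" "v \<in> X" "{u, v} \<in> E"
      moreover have "{u, v} \<inter> T \<noteq> {} \<longrightarrow> {u, v} \<inter> (V - X) \<noteq> {}"
        using c \<open>{u, v} \<in> E\<close> unfolding T_vertex_cover_def by (elim conjE) (rule bspec)
      ultimately show False by simp
    qed
  next
    assume n: "no_edge E (X \<inter> T) X"
    show "T_vertex_cover V E T (V - X)" unfolding T_vertex_cover_def
    proof (intro conjI ballI impI notI)
      fix e assume e: "e \<in> E" "e \<inter> T \<noteq> {}" "e \<inter> (V - X) = {}"
      obtain a b where ab: "e = {a, b}" "a \<in> V" "b \<in> V" using edge e by blast
      have "a \<in> X" "b \<in> X" using e(3) ab by auto
      moreover have "a \<in> T \<or> b \<in> T" using e ab by auto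
      ultimately show False using n e(1) ab(1) unfolding no_edge_def by (metis IntI insert_commute)
    qed simp
  qed
  show ?thesis
  proof
    assume "subset_vertex_cover V E T k"
    then obtain S where S: "T_vertex_cover V E T S" "card S \<le> k" unfolding subset_vertex_cover_def by blast
    then have SV: "S \<subseteq> V" by (simp add: T_vertex_cover_def)
    then have "V - (V - S) = S" by blast
    then have "no_edge E ((V - S) \<inter> T) (V - S)" using compl[of "V - S"] S by auto
    moreover have "card V - card (V - S) = card S"
      using SV fin by (simp add: card_Diff_subset card_mono finite_subset)
    ultimately show "\<exists>X\<subseteq>V. no_edge E (X \<inter> T) X \<and> card V - card X \<le> k"
      using S by (intro exI[of _ "V - S"]) auto
  next
    assume "\<exists>X\<subseteq>V. no_edge E (X \<inter> T) X \<and> card V - card X \<le> k"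
    then obtain X where "X \<subseteq> V" "no_edge E (X \<inter> T) X" "card V - card X \<le> k" by blast
    then show "subset_vertex_cover V E T k"
      unfolding subset_vertex_cover_def using fin compl
      by (intro exI[of _ "V - X"]) (simp add: card_Diff_subset finite_subset)
  qed
qed

section \<open>Counting steps\<close>

lemma length_postfix_pos: "0 < length (postfix x)"
  by (induction x) auto

lemma length_postfix: "length (postfix x) + 1 = 2 * length (leaves x)"
  by (induction x) auto

lemma leaves_subset_nodes: "y \<in> nodes x \<Longrightarrow> set (leaves y) \<subseteq> set (leaves x)"
  by (induction x) auto

lemma leaves_nonempty: "leaves x \<noteq> []"
  by (induction x) auto

lemma finite_nodes: "finite (nodes x)"
  by (induction x) auto

text \<open>Subtrees sharing no leaf are different because every subtree has a leaf. Needed to split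
  sums over \<open>nodes\<close> at the root.\<close>

lemma nodes_disjoint:
  assumes "distinct (leaves (Node l r))"
  shows "nodes l \<inter> nodes r = {}" "Node l r \<notin> nodes l \<union> nodes r"
proof -
  have d: "set (leaves l) \<inter> set (leaves r) = {}" using assms by simp
  show "nodes l \<inter> nodes r = {}"
  proof (rule equals0I)
    fix y assume "y \<in> nodes l \<inter> nodes r"
    then have "set (leaves y) \<subseteq> set (leaves l) \<inter> set (leaves r)" using leaves_subset_nodes by blast
    then show False using d leaves_nonempty[of y] by simp
  qed
  have "set (leaves (Node l r)) \<subseteq> set (leaves l) \<Longrightarrow> False"
    "set (leaves (Node l r)) \<subseteq> set (leaves r) \<Longrightarrow> False"
    using d leaves_nonempty[of l] leaves_nonempty[of r] by (simp_all add: Int_absorb1 Int_absorb2)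
  then show "Node l r \<notin> nodes l \<union> nodes r" using leaves_subset_nodes by blast
qed

lemma card_nodes: "distinct (leaves x) \<Longrightarrow> card (nodes x) + 1 = 2 * length (leaves x)"
proof (induction x)
  case (Node l r)
  then show ?case using nodes_disjoint[OF Node.prems]
    by (simp add: card_Un_disjoint finite_nodes)
qed simp

text \<open>Running time in units of \<open>n\<close> steps, up to a constant. \<open>N\<close> will
  be twice the number of classes.\<close>

fun work :: "('a layout \<Rightarrow> nat) \<Rightarrow> 'a layout \<Rightarrow> nat" where
  "work N (Leaf v) = 1"
| "work N (Node l r) = work N l + work N r + (N l * N r) ^ 2"

text \<open>
  The summand \<open>N x ^ 4\<close> on the left pays for the work at the parent of \<open>x\<close>.
\<close>

lemma work_le:
  assumes "distinct (leaves x)" "\<And>y. y \<in> nodes x \<Longrightarrow> 1 \<le> N y"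
  shows "work N x + N x ^ 4 \<le> 2 * (\<Sum>y\<in>nodes x. N y ^ 4)"
  using assms
proof (induction x)
  case (Leaf v)
  then have "1 \<le> N (Leaf v) ^ 4" by simp
  then show ?case by simp
next
  case (Node l r)
  have sum: "(\<Sum>y\<in>nodes (Node l r). N y ^ 4) =
      N (Node l r) ^ 4 + ((\<Sum>y\<in>nodes l. N y ^ 4) + (\<Sum>y\<in>nodes r. N y ^ 4))"
    using nodes_disjoint[OF Node.prems(1)] by (simp add: sum.union_disjoint finite_nodes)
  have IH: "work N l + N l ^ 4 \<le> 2 * (\<Sum>y\<in>nodes l. N y ^ 4)"
    "work N r + N r ^ 4 \<le> 2 * (\<Sum>y\<in>nodes r. N y ^ 4)"
    using Node by auto
  have "(N l * N r) ^ 2 \<le> (max (N l) (N r) * max (N l) (N r)) ^ 2"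
    by (intro power_mono mult_mono) auto
  also have "\<dots> = max (N l) (N r) ^ 4" by (simp add: power2_eq_square power4_eq_xxxx)
  also have "\<dots> \<le> N l ^ 4 + N r ^ 4" by (simp add: max_def)
  finally show ?case using IH sum by simp
qed

lemma two_le_nec1:
  assumes G: "simple_graph V E" and v: "v \<in> V" and e: "{v, u} \<in> E"
  shows "2 \<le> nec1 V E {v}"
proof (rule card_le_nec1[where R = "leaf_rep v"])
  have "u \<in> V" "u \<noteq> v" using G e unfolding simple_graph_def by fastforce+
  then have "boundary V E {v} {v} \<noteq> boundary V E {v} {}" using e unfolding boundary_def by auto
  then have "inj_on (\<lambda>i. boundary V E {v} (leaf_rep v i)) {0, 1}" by (auto simp: leaf_rep_def)
  moreover have "{..<2} = {0, 1::nat}" by auto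
  ultimately show "inj_on (\<lambda>i. boundary V E {v} (leaf_rep v i)) {..<2}" by simp
qed (use assms in \<open>auto simp: simple_graph_def leaf_rep_def\<close>)

lemma leaf_in_nodes: "v \<in> set (leaves x) \<Longrightarrow> Leaf v \<in> nodes x"
  by (induction x) auto

text \<open>The 3 is 2 + 1: each of the at most \<open>2 * n\<close> nodes may leave a remainder
  \<open>n\<close>, in total at most twice \<open>layout_cost\<close> if there is an edge, and the
  rest is \<open>layout_cost\<close> itself.\<close>

lemma sum_nec1_le_time_bound:
  assumes G: "simple_graph V E" and L: "rooted_layout V L"
  shows "real (card V) * (\<Sum>x\<in>nodes L. real (nec1 V E (vertices_below x)) ^ 4) \<le> 3 * time_bound V E L"
proof -
  let ?c = "\<lambda>x. real (nec1 V E (vertices_below x))" and ?n = "real (card V)"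
  have fin: "finite V" and below: "\<And>x. x \<in> nodes L \<Longrightarrow> vertices_below x \<subseteq> V"
    using G L leaves_subset_nodes unfolding simple_graph_def rooted_layout_def vertices_below_def by fastforce+
  have c1: "1 \<le> ?c x" if "x \<in> nodes L" for x
    using nec1_ge_1[OF fin below[OF that]] by (metis of_nat_1 of_nat_le_iff)
  have V: "V = set (leaves L)" using L by (simp add: rooted_layout_def)
  have "V \<noteq> {}" using leaves_nonempty[of L] V by simp
  then have n1: "1 \<le> ?n" using fin by (metis One_nat_def Suc_leI card_gt_0_iff of_nat_1 of_nat_le_iff)
  have "card (nodes L) \<le> 2 * card V"
    using card_nodes[of L] L V by (simp add: rooted_layout_def distinct_card)
  then have nodes: "real (card (nodes L)) \<le> 2 * ?n" by linarith
  show ?thesis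
  proof (cases "E = {}")
    case True
    have "?c x = 1" if "x \<in> nodes L" for x
    proof -
      have "boundary V E (vertices_below x) ` Pow (vertices_below x) = {{}}" by (auto simp: boundary_def True)
      then show ?thesis by (simp add: nec1_eq_card_boundary[OF fin below[OF that]])
    qed
    then have "?n * (\<Sum>x\<in>nodes L. ?c x ^ 4) = ?n * real (card (nodes L))" by simp
    also have "\<dots> \<le> ?n * (2 * ?n)" using nodes by (intro mult_left_mono) auto
    also have "\<dots> \<le> 3 * ?n ^ 2" by (simp add: power2_eq_square)
    finally show ?thesis using True by (simp add: time_bound_def)
  next
    case False
    let ?g = "\<lambda>x. ?c x ^ 4 * ?n ^ 2 * log 2 (?c x)"
    have g0: "0 \<le> ?g x" if "x \<in> nodes L" for x
      using c1[OF that] by (intro mult_nonneg_nonneg) auto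
    obtain e where "e \<in> E" using False by blast
    then obtain v u where vu: "{v, u} \<in> E" "v \<in> V"
      using G unfolding simple_graph_def by (metis card_2_iff insert_subset)
    have "2 \<le> ?c (Leaf v)" using two_le_nec1[OF G vu(2,1)] by (simp add: vertices_below_def)
    moreover from this have "1 \<le> log 2 (?c (Leaf v))" by simp
    moreover have "1 \<le> ?c (Leaf v) ^ 4" using \<open>2 \<le> _\<close> by (intro one_le_power) auto
    ultimately have "1 * ?n ^ 2 * 1 \<le> ?g (Leaf v)" by (intro mult_mono) auto
    also have "\<dots> \<le> layout_cost V E L"
      unfolding layout_cost_def using leaf_in_nodes[of v L] vu V g0 finite_nodes[of L]
      by (intro member_le_sum) auto
    finally have n2: "?n ^ 2 \<le> layout_cost V E L" by simp
    \<comment> \<open>With one class the node is charged the additive \<open>n\<close>; with at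
      least two classes the logarithm is at least 1 and the node pays for itself.\<close>
    have node_cost: "?n * ?c x ^ 4 \<le> ?n + ?g x" if x: "x \<in> nodes L" for x
    proof (cases "nec1 V E (vertices_below x) = 1")
      case False
      then have "2 \<le> nec1 V E (vertices_below x)" using c1[OF x] by (cases "nec1 V E (vertices_below x)") auto
      then have "2 \<le> ?c x" by simp
      then have "1 \<le> log 2 (?c x)" by simp
      moreover have "?n \<le> ?n ^ 2" using n1 by (intro self_le_power) auto
      ultimately have "?c x ^ 4 * ?n * 1 \<le> ?g x" by (intro mult_mono) auto
      then show ?thesis by (simp add: mult.commute)
    qed auto
    have "?n * (\<Sum>x\<in>nodes L. ?c x ^ 4) = (\<Sum>x\<in>nodes L. ?n * ?c x ^ 4)" by (rule sum_distrib_left)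
    also have "\<dots> \<le> (\<Sum>x\<in>nodes L. ?n + ?g x)" using node_cost by (rule sum_mono)
    also have "\<dots> = real (card (nodes L)) * ?n + layout_cost V E L"
      by (simp add: sum.distrib layout_cost_def)
    also have "\<dots> \<le> 2 * ?n * ?n + layout_cost V E L"
      using nodes by (intro add_mono mult_right_mono) auto
    also have "\<dots> \<le> 3 * layout_cost V E L" using n2 by (simp add: power2_eq_square)
    finally show ?thesis using False by (simp add: time_bound_def)
  qed
qed


section \<open>The program\<close>

text \<open>
  A node of the layout is named by its position \<open>p\<close> in the postfix notation, and \<open>S p\<close> is the
  position where its subtree starts. So the right child of \<open>p\<close> is \<open>p - 1\<close> and the left child is
  \<open>S (p - 1) - 1\<close>. \<open>pos v\<close> is one more than the position of the leaf of \<open>v\<close>, or \<open>0\<close> as long as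
  this leaf is unprocessed; hence, once \<open>p\<close> has been reached and nothing after it, the vertices
  below \<open>p\<close> are those with \<open>S p < pos v\<close>. Node \<open>p\<close> has \<open>M p\<close> classes; \<open>Z (p, i, v)\<close> is the bit of
  \<open>v\<close> in the code of the representative of class \<open>i\<close>, and \<open>F (p, i, j)\<close> the table of partial
  solutions. For classes \<open>i\<close> and \<open>j\<close> of the children, \<open>U (i, j)\<close> is the class of the union of
  their representatives, and \<open>C (i, j)\<close> tells whether there is an edge between these. A leaf always
  gets two classes, which coincide if the vertex is isolated; this accounts for the factor \<open>2\<close> in
  the bounds below.
\<close>

definition row_step :: com where
  "row_step =
     Seq (Assign ''x'' (Elem ''Z'' (triple_exp ''l'' ''i'' ''u'')))
    (Seq (Assign ''y'' (Elem ''Z'' (triple_exp ''r'' ''j'' ''u'')))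
    (If (Less (Reg ''t'') (Elem ''pos'' (Reg ''u'')))
      (Seq (Store ''Z'' (triple_exp ''p'' ''c'' ''u'') (Reg ''y''))
           (If (Conj (Equal (Reg ''x'') (Num 1)) (Equal (Reg ''y'') (Num 1)))
             (Assign ''q'' (Num 1)) Skip))
      (If (Less (Reg ''s'') (Elem ''pos'' (Reg ''u'')))
        (Store ''Z'' (triple_exp ''p'' ''c'' ''u'') (Reg ''x''))
        (If (Equal (Reg ''x'') (Num 0))
          (Store ''Z'' (triple_exp ''p'' ''c'' ''u'') (Reg ''y''))
          (Store ''Z'' (triple_exp ''p'' ''c'' ''u'') (Num 1))))))"

definition row :: com where
  "row = Seq (Assign ''q'' (Num 0)) (For ''u'' ''n'' row_step)"

text \<open>The first test skips the vertices below \<open>p\<close>: inside, the bits describe the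
  representative and may differ within a class; only the bits outside form the boundary.\<close>

definition compare_step :: com where
  "compare_step =
     If (Conj (Neg (Less (Reg ''s'') (Elem ''pos'' (Reg ''u''))))
              (Neg (Equal (Elem ''Z'' (triple_exp ''p'' ''h'' ''u''))
                          (Elem ''Z'' (triple_exp ''p'' ''c'' ''u'')))))
       (Assign ''e'' (Num 1)) Skip"

definition search_step :: com where
  "search_step = Seq (Assign ''e'' (Num 0)) (Seq (For ''u'' ''n'' compare_step)
     (If (Equal (Reg ''e'') (Num 0)) (Assign ''g'' (Reg ''h'')) Skip))"

text \<open>The default \<open>c\<close> is the index of the tentative row just written. If it
  survives, the class is new and \<open>class_step\<close> keeps the row by advancing
  \<open>c\<close>; otherwise the next union overwrites that row.\<close>

definition search :: com where
  "search = Seq (Assign ''g'' (Reg ''c'')) (For ''h'' ''c'' search_step)"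

definition class_step :: com where
  "class_step = Seq row (Seq search
    (Seq (Store ''C'' (pair_exp (Reg ''i'') (Reg ''j'')) (Reg ''q''))
    (Seq (Store ''U'' (pair_exp (Reg ''i'') (Reg ''j'')) (Reg ''g''))
    (If (Equal (Reg ''g'') (Reg ''c'')) (Assign ''c'' (Bin Plus (Reg ''c'') (Num 1))) Skip))))"

definition classes :: com where
  "classes = Seq (Assign ''c'' (Num 0)) (For ''i'' ''a'' (For ''j'' ''b'' class_step))"

text \<open>Lower-case indices stand for the part in \<open>T\<close>, capital ones for the whole
  partial solution. Hence conflicts are looked up at \<open>(i, J)\<close> and
  \<open>(I, j)\<close>, but not at \<open>(I, J)\<close>, where edges avoiding \<open>T\<close> are
  allowed.\<close>

definition table_step :: com where
  "table_step =
     Seq (Assign ''x'' (Elem ''F'' (triple_exp ''l'' ''i'' ''I'')))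
    (Seq (Assign ''y'' (Elem ''F'' (triple_exp ''r'' ''j'' ''J'')))
    (If (Conj (Conj (Less (Num 0) (Reg ''x'')) (Less (Num 0) (Reg ''y'')))
              (Conj (Equal (Elem ''C'' (pair_exp (Reg ''i'') (Reg ''J''))) (Num 0))
                    (Equal (Elem ''C'' (pair_exp (Reg ''I'') (Reg ''j''))) (Num 0))))
      (Seq (Assign ''x'' (Bin Minus (Bin Plus (Reg ''x'') (Reg ''y'')) (Num 1)))
      (Seq (Assign ''g'' (Elem ''U'' (pair_exp (Reg ''i'') (Reg ''j''))))
      (Seq (Assign ''h'' (Elem ''U'' (pair_exp (Reg ''I'') (Reg ''J''))))
      (If (Less (Elem ''F'' (triple_exp ''p'' ''g'' ''h'')) (Reg ''x''))
        (Store ''F'' (triple_exp ''p'' ''g'' ''h'') (Reg ''x'')) Skip))))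
      Skip))"

definition table :: com where
  "table = For ''i'' ''a'' (For ''I'' ''a'' (For ''j'' ''b'' (For ''J'' ''b'' table_step)))"

definition inner_head :: com where
  "inner_head =
     Seq (Assign ''r'' (Bin Minus (Reg ''p'') (Num 1)))
    (Seq (Assign ''t'' (Elem ''S'' (Reg ''r'')))
    (Seq (Assign ''l'' (Bin Minus (Reg ''t'') (Num 1)))
    (Seq (Assign ''s'' (Elem ''S'' (Reg ''l'')))
    (Seq (Assign ''a'' (Elem ''M'' (Reg ''l'')))
    (Seq (Assign ''b'' (Elem ''M'' (Reg ''r'')))
         (Store ''S'' (Reg ''p'') (Reg ''s'')))))))"

definition inner_node :: com where
  "inner_node = Seq inner_head (Seq classes (Seq (Store ''M'' (Reg ''p'') (Reg ''c'')) table))"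

text \<open>Row 1, for the representative \<open>{v}\<close>, is the adjacency row of
  \<open>v\<close>; \<open>leaf_tail\<close> then sets the bit of \<open>v\<close> itself. Row 0,
  for the empty set, is correct without being written.\<close>

definition leaf_step :: com where
  "leaf_step = Store ''Z'' (triple_exp ''p'' ''o'' ''u'')
     (Elem ''adj'' (Bin Plus (Bin Times (Reg ''v'') (Reg ''n'')) (Reg ''u'')))"

text \<open>\<open>o\<close> and \<open>z\<close> hold the constants 1 and 0 because
  \<open>triple_exp\<close> takes names of registers.\<close>

definition leaf_head :: com where
  "leaf_head =
     Seq (Assign ''v'' (Bin Minus (Elem ''L'' (Reg ''p'')) (Num 1)))
    (Seq (Assign ''o'' (Num 1))
    (Seq (Assign ''z'' (Num 0))
    (Seq (Store ''pos'' (Reg ''v'') (Bin Plus (Reg ''p'') (Num 1)))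
    (Seq (Store ''S'' (Reg ''p'') (Reg ''p''))
         (Store ''M'' (Reg ''p'') (Num 2))))))"

definition leaf_tail :: com where
  "leaf_tail =
     Seq (Store ''Z'' (triple_exp ''p'' ''o'' ''v'') (Num 1))
    (Seq (Store ''F'' (triple_exp ''p'' ''z'' ''z'') (Num 1))
    (Seq (Assign ''g'' (Elem ''T'' (Reg ''v'')))
         (Store ''F'' (triple_exp ''p'' ''g'' ''o'') (Num 2))))"

definition leaf_node :: com where
  "leaf_node = Seq leaf_head (Seq (For ''u'' ''n'' leaf_step) leaf_tail)"

definition node_step :: com where
  "node_step = Seq (If (Equal (Elem ''L'' (Reg ''p'')) (Num 0)) inner_node leaf_node)
     (Assign ''p'' (Bin Plus (Reg ''p'') (Num 1)))"

definition maximum_step :: com where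
  "maximum_step = If (Less (Reg ''x'') (Elem ''F'' (triple_exp ''r'' ''i'' ''j'')))
     (Assign ''x'' (Elem ''F'' (triple_exp ''r'' ''i'' ''j''))) Skip"

definition finish_head :: com where
  "finish_head =
     Seq (Assign ''r'' (Bin Minus (Reg ''p'') (Num 1)))
    (Seq (Assign ''a'' (Elem ''M'' (Reg ''r'')))
         (Assign ''x'' (Num 0)))"

text \<open>\<open>x\<close> is one more than the largest size of a complement, so
  \<open>n + 1 - x\<close> is the least size of a cover.\<close>

definition finish_tail :: com where
  "finish_tail = If (Less (Reg ''k'') (Bin Minus (Bin Plus (Reg ''n'') (Num 1)) (Reg ''x'')))
     Skip (Assign ''answer'' (Num 1))"

definition finish :: com where
  "finish = Seq finish_head (Seq (For ''i'' ''a'' (For ''j'' ''a'' maximum_step)) finish_tail)"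

abbreviation main_loop :: com where
  "main_loop \<equiv> While (Less (Reg ''p'') (Reg ''m'')) node_step"

text \<open>A layout with \<open>n\<close> leaves has \<open>2 * n - 1\<close> nodes, which is the
  length of its postfix notation.\<close>

definition solver :: com where
  "solver = Seq (Assign ''m'' (Bin Minus (Bin Plus (Reg ''n'') (Reg ''n'')) (Num 1)))
     (Seq main_loop finish)"

lemmas block_defs = row_step_def row_def compare_step_def search_step_def search_def class_step_def
  classes_def table_step_def table_def

lemma written_blocks [simp]:
  "written_regs row_step = {''x'', ''y'', ''q''}" "written_arrs row_step = {''Z''}"
  "written_regs row = {''x'', ''y'', ''q'', ''u''}" "written_arrs row = {''Z''}"
  "written_regs compare_step = {''e''}" "written_arrs compare_step = {}"
  "written_regs search_step = {''e'', ''u'', ''g''}" "written_arrs search_step = {}"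
  "written_regs search = {''e'', ''u'', ''g'', ''h''}" "written_arrs search = {}"
  "written_regs class_step = {''x'', ''y'', ''q'', ''u'', ''e'', ''g'', ''h'', ''c''}"
  "written_arrs class_step = {''Z'', ''C'', ''U''}"
  "written_regs classes = {''x'', ''y'', ''q'', ''u'', ''e'', ''g'', ''h'', ''c'', ''i'', ''j''}"
  "written_arrs classes = {''Z'', ''C'', ''U''}"
  "written_regs table_step = {''x'', ''y'', ''g'', ''h''}" "written_arrs table_step = {''F''}"
  "written_regs table = {''x'', ''y'', ''g'', ''h'', ''i'', ''I'', ''j'', ''J''}"
  "written_arrs table = {''F''}"
  "written_regs leaf_step = {}" "written_arrs leaf_step = {''Z''}"
  "written_regs maximum_step = {''x''}" "written_arrs maximum_step = {}"
  by (auto simp: block_defs leaf_step_def maximum_step_def)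

section \<open>Correctness of the computation of rows and classes\<close>

abbreviation row_cell :: "state \<Rightarrow> nat \<Rightarrow> nat \<Rightarrow> nat \<Rightarrow> nat" where
  "row_cell s p i v \<equiv> arr s ''Z'' (triple p i v)"

abbreviation table_cell :: "state \<Rightarrow> nat \<Rightarrow> nat \<Rightarrow> nat \<Rightarrow> nat" where
  "table_cell s p i j \<equiv> arr s ''F'' (triple p i j)"

text \<open>\<open>K\<close> is to bound all components of addresses, so that every
  \<open>triple\<close> fits into a word. The term \<open>2 * n + 2\<close> is the largest sum of
  two table entries, formed in \<open>table_step\<close> before 1 is subtracted.\<close>

locale word_ram =
  fixes w K n :: nat
  assumes K: "125 * K ^ 4 < 2 ^ w" and n_K: "2 * n + 2 \<le> K" and n_pos: "0 < n"
begin

lemma K_le: "K \<le> 125 * K ^ 4" "5 * K ^ 2 \<le> 125 * K ^ 4"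
proof -
  have "1 \<le> K" using n_K by simp
  then have "K ^ 1 \<le> K ^ 4" "K ^ 2 \<le> K ^ 4" by (intro power_increasing; simp)+
  then show "K \<le> 125 * K ^ 4" "5 * K ^ 2 \<le> 125 * K ^ 4" by simp_all
qed

lemma fits: "x \<le> K \<Longrightarrow> x < 2 ^ w"
  using K K_le by linarith

lemma pair_fits: "x \<le> K \<Longrightarrow> y \<le> K \<Longrightarrow> pair x y < 2 ^ w"
  using pair_le[of x K y] K K_le by linarith

lemma triple_fits: "x \<le> K \<Longrightarrow> y \<le> K \<Longrightarrow> z \<le> K \<Longrightarrow> triple x y z < 2 ^ w"
  using triple_le[of x K y z] K by linarith

lemma small_fits: "x \<le> 2 \<Longrightarrow> x < 2 ^ w" for x :: nat
  using fits[of x] n_K by simp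

lemma n_le: "v < n \<Longrightarrow> v \<le> K" "n \<le> K"
  using n_K by auto

lemma runs_row:
  assumes regs: "reg s ''n'' = n" "reg s ''p'' = p" "reg s ''c'' = c" "reg s ''i'' = i" "reg s ''j'' = j"
      "reg s ''l'' = l" "reg s ''r'' = r" "reg s ''s'' \<le> K" "reg s ''t'' \<le> K"
    and le: "p \<le> K" "c \<le> K" "i \<le> K" "j \<le> K" "l < p" "r < p"
    and AB: "A \<inter> B = {}" "A \<subseteq> {..<n}" "B \<subseteq> {..<n}" "X \<subseteq> A" "Y \<subseteq> B"
    and rows: "\<And>v. v < n \<Longrightarrow> row_cell s l i v = of_bool (code E A X v)"
      "\<And>v. v < n \<Longrightarrow> row_cell s r j v = of_bool (code E B Y v)"
    and pos: "\<And>v. v < n \<Longrightarrow> arr s ''pos'' v \<le> K"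
      "\<And>v. v < n \<Longrightarrow> reg s ''t'' < arr s ''pos'' v \<longleftrightarrow> v \<in> B"
      "\<And>v. v < n \<Longrightarrow> reg s ''s'' < arr s ''pos'' v \<longleftrightarrow> v \<in> A \<union> B"
    and Q: "\<And>s'. frame (written_regs row) (written_arrs row) s s' \<Longrightarrow>
      \<forall>v<n. row_cell s' p c v = of_bool (code E (A \<union> B) (X \<union> Y) v) \<Longrightarrow>
      \<forall>q i v. (q, i) \<noteq> (p, c) \<longrightarrow> row_cell s' q i v = row_cell s q i v \<Longrightarrow>
      reg s' ''q'' = of_bool (\<not> no_edge E X Y) \<Longrightarrow> Q s'"
  shows "runs w row s (200 * n + 10) Q"
proof -
  define I where "I = (\<lambda>k s'. (\<forall>v<k. row_cell s' p c v = of_bool (code E (A \<union> B) (X \<union> Y) v)) \<and>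
      (\<forall>q i v. (q, i) \<noteq> (p, c) \<longrightarrow> row_cell s' q i v = row_cell s q i v) \<and>
      reg s' ''q'' = of_bool (\<exists>v<k. v \<in> B \<and> code E A X v \<and> code E B Y v))"
  let ?s0 = "s\<lparr>reg := (reg s)(''q'' := 0)\<rparr>"
  have loop: "runs w (For ''u'' ''n'' row_step) ?s0 (200 * n + 5) (\<lambda>s'. I n s')"
  \<comment> \<open>193 plus the loop overhead 7 makes 200 per vertex; the 93 in other loops is
    chosen likewise.\<close>
  proof (rule runs_For[where I = I and h = n and tb = 193])
    fix k s1 assume k: "k < n" and I: "I k s1" and u: "reg s1 ''u'' = k"
      and f: "frame (insert ''u'' (written_regs row_step)) (written_arrs row_step) ?s0 s1"
    have R: "reg s1 ''n'' = n" "reg s1 ''p'' = p" "reg s1 ''c'' = c" "reg s1 ''i'' = i"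
      "reg s1 ''j'' = j" "reg s1 ''l'' = l" "reg s1 ''r'' = r" "reg s1 ''s'' = reg s ''s''"
      "reg s1 ''t'' = reg s ''t''" "arr s1 ''pos'' = arr s ''pos''"
      using f regs by (simp_all add: frame_def)
    have Z: "row_cell s1 l i k = of_bool (code E A X k)" "row_cell s1 r j k = of_bool (code E B Y k)"
      using I rows k le unfolding I_def by simp_all
    have lr: "l \<le> K" "r \<le> K" "k \<le> K" using le k n_le by auto
    show "runs w row_step s1 193 (I (Suc k))"
    proof (rule runs_wp)
      show "wp w row_step (I (Suc k)) s1"
        using I AB k unfolding row_step_def I_def
        by (auto simp: R u Z pos pair_fits triple_fits fits small_fits le lr regs code_union less_Suc_eq)
    qed (simp add: row_step_def)
  next
    show "I 0 ?s0" by (simp add: I_def)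
  next
    show "I k (s\<lparr>reg := (reg s)(''u'' := v)\<rparr>) = I k s" for k s v by (simp add: I_def)
  qed (use regs n_le in \<open>simp_all add: fits\<close>)
  show ?thesis
    unfolding row_def
  proof (rule runs_seq)
    show "runs w (Assign ''q'' (Num 0)) s 2 (\<lambda>s'. runs w (For ''u'' ''n'' row_step) s' (200 * n + 5) Q)"
    proof (rule runs_wp)
      have "runs w (For ''u'' ''n'' row_step) ?s0 (200 * n + 5) Q"
      proof (rule runs_mono[OF loop order_refl])
        fix s' assume I: "I n s'" and f: "frame (written_regs (For ''u'' ''n'' row_step))
          (written_arrs (For ''u'' ''n'' row_step)) ?s0 s'"
        have "(\<exists>v<n. v \<in> B \<and> code E A X v \<and> code E B Y v) \<longleftrightarrow> \<not> no_edge E X Y"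
          using code_conflict[OF AB(1,5), of E X] AB(3) by blast
        then show "Q s'" using I f unfolding I_def by (intro Q) (auto simp: frame_def)
      qed
      then show "wp w (Assign ''q'' (Num 0)) (\<lambda>s'. runs w (For ''u'' ''n'' row_step) s' (200 * n + 5) Q) s"
        by (simp add: small_fits)
    qed simp
  qed simp
qed

end


context word_ram
begin

lemma runs_search:
  assumes regs: "reg s ''n'' = n" "reg s ''p'' = p" "reg s ''c'' = c" "reg s ''s'' \<le> K"
    and le: "p \<le> K" "c \<le> K"
    and rows: "\<And>h v. h < c \<Longrightarrow> v < n \<Longrightarrow> row_cell s p h v = of_bool (code E D (R h) v)"
      "\<And>v. v < n \<Longrightarrow> row_cell s p c v = of_bool (code E D X v)"
    and pos: "\<And>v. v < n \<Longrightarrow> arr s ''pos'' v \<le> K"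
      "\<And>v. v < n \<Longrightarrow> reg s ''s'' < arr s ''pos'' v \<longleftrightarrow> v \<in> D"
    and Q: "\<And>s'. frame (written_regs search) (written_arrs search) s s' \<Longrightarrow>
      reg s' ''g'' \<le> c \<Longrightarrow>
      reg s' ''g'' < c \<longrightarrow> boundary {..<n} E D (R (reg s' ''g'')) = boundary {..<n} E D X \<Longrightarrow>
      reg s' ''g'' = c \<longrightarrow> (\<forall>h<c. boundary {..<n} E D (R h) \<noteq> boundary {..<n} E D X) \<Longrightarrow> Q s'"
  shows "runs w search s (c * (100 * n + 30) + 10) Q"
proof -
  \<comment> \<open>The search does not stop at a match, so after a hit the invariant only says that
    \<open>g\<close> is some matching row.\<close>
  define I where "I = (\<lambda>k (s' :: state). (reg s' ''g'' = c \<and>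
      (\<forall>h<k. boundary {..<n} E D (R h) \<noteq> boundary {..<n} E D X)) \<or>
      (reg s' ''g'' < c \<and> boundary {..<n} E D (R (reg s' ''g'')) = boundary {..<n} E D X))"
  let ?s0 = "s\<lparr>reg := (reg s)(''g'' := c)\<rparr>"
  have loop: "runs w (For ''h'' ''c'' search_step) ?s0 (c * (100 * n + 30) + 5) (\<lambda>s'. I c s')"
  proof (rule runs_For[where I = I and h = c and tb = "100 * n + 20"])
    fix k s1 assume k: "k < c" and I: "I k s1" and h: "reg s1 ''h'' = k"
      and f: "frame (insert ''h'' (written_regs search_step)) (written_arrs search_step) ?s0 s1"
    define differ where "differ = (\<lambda>v. v \<notin> D \<and> code E D (R k) v \<noteq> code E D X v)"
    define I' where "I' = (\<lambda>k' (s' :: state). reg s' ''e'' = of_bool (\<exists>v<k'. differ v))"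
    let ?s1 = "s1\<lparr>reg := (reg s1)(''e'' := 0)\<rparr>"
    have inner: "runs w (For ''u'' ''n'' compare_step) ?s1 (100 * n + 5) (\<lambda>s'. I' n s')"
    proof (rule runs_For[where I = I' and h = n and tb = 93])
      fix k' s2 assume k': "k' < n" and I': "I' k' s2" and u: "reg s2 ''u'' = k'"
        and f': "frame (insert ''u'' (written_regs compare_step)) (written_arrs compare_step) ?s1 s2"
      have R: "reg s2 ''p'' = p" "reg s2 ''c'' = c" "reg s2 ''s'' = reg s ''s''" "reg s2 ''h'' = k"
        "arr s2 ''pos'' = arr s ''pos''" "arr s2 ''Z'' = arr s ''Z''"
        using f f' regs h by (simp_all add: frame_def)
      have hk: "k \<le> K" "k' \<le> K" using k k' le n_le by auto
      show "runs w compare_step s2 93 (I' (Suc k'))"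
      proof (rule runs_wp)
        have "(\<exists>v<Suc k'. differ v) = (differ k' \<or> (\<exists>v<k'. differ v))"
          by (auto simp: less_Suc_eq)
        then have "I' (Suc k') s' \<longleftrightarrow> reg s' ''e'' = of_bool (differ k' \<or> reg s2 ''e'' = 1)" for s'
          using I' unfolding I'_def by auto
        moreover have "reg s2 ''e'' = 0 \<or> reg s2 ''e'' = 1" using I' unfolding I'_def by auto
        ultimately show "wp w compare_step (I' (Suc k')) s2"
          using k k' unfolding compare_step_def differ_def
          by (auto simp: R u rows pos triple_fits pair_fits fits small_fits le hk regs)
      qed (simp add: compare_step_def)
    next
      show "I' 0 ?s1" by (simp add: I'_def)
    next
      show "I' k (s\<lparr>reg := (reg s)(''u'' := v)\<rparr>) = I' k s" for k s v by (simp add: I'_def)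
    next
      show "reg ?s1 ''n'' = n" using f regs by (simp add: frame_def)
    qed (use regs n_le in \<open>simp_all add: fits\<close>)
    show "runs w search_step s1 (100 * n + 20) (I (Suc k))"
      unfolding search_step_def
    proof (rule runs_seq)
      show "runs w (Assign ''e'' (Num 0)) s1 2 (\<lambda>s'. runs w (Seq (For ''u'' ''n'' compare_step)
        (If (Equal (Reg ''e'') (Num 0)) (Assign ''g'' (Reg ''h'')) Skip)) s' (100 * n + 15) (I (Suc k)))"
      proof (rule runs_wp)
        have "runs w (Seq (For ''u'' ''n'' compare_step)
          (If (Equal (Reg ''e'') (Num 0)) (Assign ''g'' (Reg ''h'')) Skip)) ?s1 (100 * n + 15) (I (Suc k))"
        proof (rule runs_seq_frame[OF inner, where ?B2.0 = 9])
          fix s2 assume I': "I' n s2"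
            and f': "frame (written_regs (For ''u'' ''n'' compare_step))
              (written_arrs (For ''u'' ''n'' compare_step)) ?s1 s2"
          have "(\<exists>v<n. differ v) \<longleftrightarrow>
              boundary {..<n} E D (R k) \<noteq> boundary {..<n} E D X"
            unfolding boundary_eq_iff_code differ_def by auto
          with I' have e: "reg s2 ''e'' = of_bool (boundary {..<n} E D (R k) \<noteq> boundary {..<n} E D X)"
            unfolding I'_def by simp
          have R: "reg s2 ''h'' = k" "reg s2 ''g'' = reg s1 ''g''" using f' h by (simp_all add: frame_def)
          have "k \<le> K" using k le by simp
          then show "runs w (If (Equal (Reg ''e'') (Num 0)) (Assign ''g'' (Reg ''h'')) Skip) s2 9 (I (Suc k))"
            using I k unfolding I_def
            by (intro runs_wp) (auto simp: e R fits small_fits less_Suc_eq)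
        qed simp
        then show "wp w (Assign ''e'' (Num 0)) (\<lambda>s'. runs w (Seq (For ''u'' ''n'' compare_step)
          (If (Equal (Reg ''e'') (Num 0)) (Assign ''g'' (Reg ''h'')) Skip)) s' (100 * n + 15) (I (Suc k))) s1"
          by (simp add: small_fits)
      qed simp
    qed simp
  next
    show "I 0 ?s0" by (simp add: I_def)
  next
    show "I k (s\<lparr>reg := (reg s)(''h'' := v)\<rparr>) = I k s" for k s v by (simp add: I_def)
  qed (use regs le in \<open>simp_all add: fits\<close>)
  show ?thesis
    unfolding search_def
  proof (rule runs_seq)
    show "runs w (Assign ''g'' (Reg ''c'')) s 2
      (\<lambda>s'. runs w (For ''h'' ''c'' search_step) s' (c * (100 * n + 30) + 5) Q)"
    proof (rule runs_wp)
      have "runs w (For ''h'' ''c'' search_step) ?s0 (c * (100 * n + 30) + 5) Q"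
      proof (rule runs_mono[OF loop order_refl])
        fix s' assume I: "I c s'" and f: "frame (written_regs (For ''h'' ''c'' search_step))
          (written_arrs (For ''h'' ''c'' search_step)) ?s0 s'"
        have "frame (written_regs search) (written_arrs search) s s'"
          using f by (simp add: frame_def)
        then show "Q s'" by (rule Q) (use I in \<open>unfold I_def, linarith | blast\<close>)+
      qed
      then show "wp w (Assign ''g'' (Reg ''c''))
          (\<lambda>s'. runs w (For ''h'' ''c'' search_step) s' (c * (100 * n + 30) + 5) Q) s"
        using regs le by (simp add: fits)
    qed simp
  qed simp
qed

end

text \<open>
  The node \<open>p\<close> with vertex set \<open>A \<union> B\<close> has the children \<open>l\<close> and \<open>r\<close>; the state \<open>s0\<close> is the one in
  which the classes of \<open>p\<close> start to be computed.
\<close>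

locale merging = word_ram +
  fixes E :: "nat set set" and T A B :: "nat set" and p l r a b :: nat and RA RB :: "nat \<Rightarrow> nat set"
    and s0 :: state
  assumes regs: "reg s0 ''n'' = n" "reg s0 ''p'' = p" "reg s0 ''l'' = l" "reg s0 ''r'' = r"
      "reg s0 ''a'' = a" "reg s0 ''b'' = b" "reg s0 ''s'' \<le> K" "reg s0 ''t'' \<le> K"
    and le: "p \<le> K" "l < p" "r < p" "a \<le> K" "b \<le> K" "nec1 {..<n} E (A \<union> B) \<le> K"
    and AB: "A \<inter> B = {}" "A \<subseteq> {..<n}" "B \<subseteq> {..<n}"
    and RA: "\<And>i. i < a \<Longrightarrow> RA i \<subseteq> A" and RB: "\<And>j. j < b \<Longrightarrow> RB j \<subseteq> B"
    and rows: "\<And>i v. i < a \<Longrightarrow> v < n \<Longrightarrow> row_cell s0 l i v = of_bool (code E A (RA i) v)"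
      "\<And>j v. j < b \<Longrightarrow> v < n \<Longrightarrow> row_cell s0 r j v = of_bool (code E B (RB j) v)"
    and pos: "\<And>v. v < n \<Longrightarrow> arr s0 ''pos'' v \<le> K"
      "\<And>v. v < n \<Longrightarrow> reg s0 ''t'' < arr s0 ''pos'' v \<longleftrightarrow> v \<in> B"
      "\<And>v. v < n \<Longrightarrow> reg s0 ''s'' < arr s0 ''pos'' v \<longleftrightarrow> v \<in> A \<union> B"
begin

text \<open>Nothing is said about row \<open>m\<close> of \<open>p\<close>, which may contain a
  rejected union.\<close>

definition class_rows :: "nat \<Rightarrow> (nat \<Rightarrow> nat set) \<Rightarrow> state \<Rightarrow> bool" where
  "class_rows m R s \<longleftrightarrow> (\<forall>h<m. R h \<subseteq> A \<union> B \<and>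
      (\<forall>v<n. row_cell s p h v = of_bool (code E (A \<union> B) (R h) v))) \<and>
     inj_on (\<lambda>h. boundary {..<n} E (A \<union> B) (R h)) {..<m} \<and>
     (\<forall>q i v. q \<noteq> p \<longrightarrow> row_cell s q i v = row_cell s0 q i v)"

definition pair_entries :: "nat \<Rightarrow> (nat \<Rightarrow> nat set) \<Rightarrow> (nat \<times> nat) set \<Rightarrow> state \<Rightarrow> bool" where
  "pair_entries m R D s \<longleftrightarrow> (\<forall>(i, j)\<in>D. arr s ''U'' (pair i j) < m \<and>
     boundary {..<n} E (A \<union> B) (R (arr s ''U'' (pair i j))) = boundary {..<n} E (A \<union> B) (RA i \<union> RB j) \<and>
     arr s ''C'' (pair i j) = of_bool (\<not> no_edge E (RA i) (RB j)))"

text \<open>The number of rows is bounded twice: by the number of processed pairs, which gives the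
  running time, and by \<open>nec1\<close> through injectivity in \<open>class_rows\<close>, which
  gives that \<open>c\<close> fits into a word.\<close>

definition class_inv :: "(nat \<times> nat) set \<Rightarrow> state \<Rightarrow> bool" where
  "class_inv D s \<longleftrightarrow> reg s ''c'' \<le> card D \<and>
     (\<exists>R. class_rows (reg s ''c'') R s \<and> pair_entries (reg s ''c'') R D s)"

lemma class_count_le:
  assumes "class_rows m R s"
  shows "m \<le> nec1 {..<n} E (A \<union> B)"
  using assms AB unfolding class_rows_def by (intro card_le_nec1[where R = R]) auto

lemma runs_class_step:
  assumes ij: "i < a" "j < b" "(i, j) \<notin> D" "D \<subseteq> {..<a} \<times> {..<b}"
    and inv: "class_inv D s" and s: "reg s ''i'' = i" "reg s ''j'' = j"
    and fr: "frame (written_regs classes) (written_arrs classes) s0 s"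
  shows "runs w class_step s (400 * (n * (a * b))) (class_inv (insert (i, j) D))"
proof -
  obtain R c where c: "reg s ''c'' = c" "c \<le> card D" and R: "class_rows c R s" "pair_entries c R D s"
    using inv unfolding class_inv_def by blast
  have cK: "c \<le> K" using class_count_le[OF R(1)] le by simp
  have "card D \<le> card ({..<a} \<times> {..<b})" using ij by (intro card_mono) auto
  then have cab: "c \<le> a * b" using c by simp
  have ab: "1 \<le> a * b" using ij by simp
  have finD: "finite D" using ij finite_subset by blast
  let ?D = "A \<union> B" and ?X = "RA i \<union> RB j"
  have regs': "reg s ''n'' = n" "reg s ''p'' = p" "reg s ''l'' = l" "reg s ''r'' = r"
    "reg s ''s'' = reg s0 ''s''" "reg s ''t'' = reg s0 ''t''" "arr s ''pos'' = arr s0 ''pos''"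
    using fr regs by (simp_all add: frame_def)
  have ij_le: "i \<le> K" "j \<le> K" using ij le by auto
  have rows': "row_cell s l i v = of_bool (code E A (RA i) v)"
    "row_cell s r j v = of_bool (code E B (RB j) v)" if "v < n" for v
    using R(1) rows ij that le unfolding class_rows_def by auto
  have pos': "arr s ''pos'' v \<le> K" "reg s ''t'' < arr s ''pos'' v \<longleftrightarrow> v \<in> B"
    "reg s ''s'' < arr s ''pos'' v \<longleftrightarrow> v \<in> A \<union> B" if "v < n" for v
    using pos[OF that] unfolding regs' by blast+
  have st: "reg s ''s'' \<le> K" "reg s ''t'' \<le> K" using regs(7,8) unfolding regs' by blast+
  define rest where "rest = Seq (Store ''C'' (pair_exp (Reg ''i'') (Reg ''j'')) (Reg ''q''))
    (Seq (Store ''U'' (pair_exp (Reg ''i'') (Reg ''j'')) (Reg ''g''))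
    (If (Equal (Reg ''g'') (Reg ''c'')) (Assign ''c'' (Bin Plus (Reg ''c'') (Num 1))) Skip))"
  show ?thesis
    unfolding class_step_def rest_def[symmetric]
  proof (rule runs_seq)
    show "runs w row s (200 * n + 10)
      (\<lambda>s1. runs w (Seq search rest) s1 (c * (100 * n + 30) + 60) (class_inv (insert (i, j) D)))"
    proof (rule runs_row[OF regs'(1,2) c(1) s regs'(3,4) st le(1) cK ij_le le(2,3) AB
          RA[OF ij(1)] RB[OF ij(2)] rows' pos'])
      fix s1
      assume f1: "frame (written_regs row) (written_arrs row) s s1"
        and new: "\<forall>v<n. row_cell s1 p c v = of_bool (code E ?D ?X v)"
        and old: "\<forall>q i v. (q, i) \<noteq> (p, c) \<longrightarrow> row_cell s1 q i v = row_cell s q i v"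
        and q: "reg s1 ''q'' = of_bool (\<not> no_edge E (RA i) (RB j))"
      have regs1: "reg s1 ''n'' = n" "reg s1 ''p'' = p" "reg s1 ''c'' = c" "reg s1 ''i'' = i"
        "reg s1 ''j'' = j" "reg s1 ''s'' = reg s0 ''s''" "arr s1 ''pos'' = arr s0 ''pos''"
        "arr s1 ''U'' = arr s ''U''" "arr s1 ''C'' = arr s ''C''"
        using f1 regs' c s by (simp_all add: frame_def)
      have row1: "row_cell s1 p h v = of_bool (code E ?D (R h) v)" if "h < c" "v < n" for h v
        using R(1) old that unfolding class_rows_def by auto
      have pos1: "arr s1 ''pos'' v \<le> K" "reg s1 ''s'' < arr s1 ''pos'' v \<longleftrightarrow> v \<in> ?D" if "v < n" for v
        using pos[OF that] unfolding regs1 by blast+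
      have st1: "reg s1 ''s'' \<le> K" using regs(7) unfolding regs1 by blast
      show "runs w (Seq search rest) s1 (c * (100 * n + 30) + 60) (class_inv (insert (i, j) D))"
      proof (rule runs_seq)
        show "runs w search s1 (c * (100 * n + 30) + 10)
          (\<lambda>s2. runs w rest s2 50 (class_inv (insert (i, j) D)))"
        proof (rule runs_search[where E = E and X = ?X, OF regs1(1-3) st1 le(1) cK row1 new[rule_format] pos1])
          fix s2
          assume f2: "frame (written_regs search) (written_arrs search) s1 s2"
            and g: "reg s2 ''g'' \<le> c"
            and found: "reg s2 ''g'' < c \<longrightarrow>
              boundary {..<n} E ?D (R (reg s2 ''g'')) = boundary {..<n} E ?D ?X"
            and fresh: "reg s2 ''g'' = c \<longrightarrow>
              (\<forall>h<c. boundary {..<n} E ?D (R h) \<noteq> boundary {..<n} E ?D ?X)"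
          have regs2: "reg s2 ''c'' = c" "reg s2 ''i'' = i" "reg s2 ''j'' = j"
            "reg s2 ''q'' = of_bool (\<not> no_edge E (RA i) (RB j))"
            "arr s2 ''Z'' = arr s1 ''Z''" "arr s2 ''U'' = arr s ''U''" "arr s2 ''C'' = arr s ''C''"
            using f2 regs1 q by (simp_all add: frame_def)
          let ?s3 = "s2\<lparr>arr := (arr s2)(''C'' := (arr s ''C'')(pair i j := reg s2 ''q''),
            ''U'' := (arr s ''U'')(pair i j := reg s2 ''g''))\<rparr>"
          have Rsub: "R h \<subseteq> ?D" if "h < c" for h using R(1) that unfolding class_rows_def by blast
          have Xsub: "?X \<subseteq> ?D" using RA RB ij by blast
          have Zold: "row_cell s2 q' i' v = row_cell s0 q' i' v" if "q' \<noteq> p" for q' i' v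
            using old R(1) that unfolding class_rows_def by (simp add: regs2)
          have inj: "inj_on (\<lambda>h. boundary {..<n} E ?D (R h)) {..<c}"
            using R(1) unfolding class_rows_def by blast
          have D: "arr s ''U'' (pair i' j') < c"
            "boundary {..<n} E ?D (R (arr s ''U'' (pair i' j'))) = boundary {..<n} E ?D (RA i' \<union> RB j')"
            "arr s ''C'' (pair i' j') = of_bool (\<not> no_edge E (RA i') (RB j'))" if "(i', j') \<in> D" for i' j'
            using R(2) that unfolding pair_entries_def by auto
          have inv_found: "class_inv (insert (i, j) D) ?s3" if gc: "reg s2 ''g'' < c"
          proof -
            have "class_rows c R ?s3"
              using Rsub row1 inj Zold unfolding class_rows_def by (simp add: regs2)
            moreover have "pair_entries c R (insert (i, j) D) ?s3"
              using D gc found ij(3) unfolding pair_entries_def by (auto simp: regs2)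
            moreover have "c \<le> card (insert (i, j) D)" using c ij finD by simp
            ultimately show ?thesis unfolding class_inv_def by (auto simp: regs2)
          qed
          have inv_fresh: "class_inv (insert (i, j) D) (?s3\<lparr>reg := (reg s2)(''c'' := Suc c)\<rparr>)"
            if gc: "reg s2 ''g'' = c"
          proof -
            let ?s4 = "?s3\<lparr>reg := (reg s2)(''c'' := Suc c)\<rparr>" and ?R = "R(c := ?X)"
            have "boundary {..<n} E ?D (R h) \<noteq> boundary {..<n} E ?D ?X" if "h < c" for h
              using fresh gc that by blast
            then have ne: "boundary {..<n} E ?D ?X \<notin> (\<lambda>h. boundary {..<n} E ?D (R h)) ` {..<c}"
              by auto
            have "inj_on (\<lambda>h. boundary {..<n} E ?D (?R h)) {..<c}"
              using inj by (auto simp: inj_on_def)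
            moreover have "(\<lambda>h. boundary {..<n} E ?D (?R h)) ` {..<c} =
                (\<lambda>h. boundary {..<n} E ?D (R h)) ` {..<c}"
              by (intro image_cong) auto
            ultimately have "inj_on (\<lambda>h. boundary {..<n} E ?D (?R h)) {..<Suc c}"
              using ne unfolding lessThan_Suc by simp
            then have "class_rows (Suc c) ?R ?s4"
              using Rsub Xsub row1 new Zold unfolding class_rows_def by (simp add: regs2 less_Suc_eq)
            moreover have "pair_entries (Suc c) ?R (insert (i, j) D) ?s4"
              unfolding pair_entries_def
            proof (intro ballI, clarify)
              fix i' j' assume mem: "(i', j') \<in> insert (i, j) D"
              show "arr ?s4 ''U'' (pair i' j') < Suc c \<and>
                boundary {..<n} E ?D (?R (arr ?s4 ''U'' (pair i' j'))) =
                  boundary {..<n} E ?D (RA i' \<union> RB j') \<and>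
                arr ?s4 ''C'' (pair i' j') = of_bool (\<not> no_edge E (RA i') (RB j'))"
              proof (cases "(i', j') = (i, j)")
                case True
                then show ?thesis using gc by (simp add: regs2)
              next
                case False
                then have "\<not> (i' = i \<and> j' = j)" "(i', j') \<in> D" using mem by auto
                then show ?thesis using D[of i' j'] by (simp only: regs2) auto
              qed
            qed
            moreover have "Suc c \<le> card (insert (i, j) D)" using c ij finD by simp
            ultimately show ?thesis unfolding class_inv_def by auto
          qed
          have gK: "reg s2 ''g'' \<le> K" using g cK by simp
          \<comment> \<open>The increment is safe only because the new union is inequivalent to all
            earlier rows: the state after the increment satisfies the invariant, and this already
            forces \<open>Suc c\<close> to be at most \<open>nec1\<close>.\<close>
          have cK': "Suc c < 2 ^ w"
            if "reg s2 ''g'' = c"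
          proof -
            have "class_inv (insert (i, j) D) (?s3\<lparr>reg := (reg s2)(''c'' := Suc c)\<rparr>)"
              using inv_fresh that by blast
            then have "Suc c \<le> nec1 {..<n} E (A \<union> B)"
              unfolding class_inv_def using class_count_le by auto
            then show ?thesis using le by (intro fits) simp
          qed
          have "wp w rest (class_inv (insert (i, j) D)) s2"
            using inv_found inv_fresh gK cK cK' g unfolding rest_def
            by (auto simp: regs2 fits small_fits pair_fits ij_le)
          then show "runs w rest s2 50 (class_inv (insert (i, j) D))"
            by (rule runs_wp[rotated]) (simp add: rest_def)
        qed
      qed simp
    qed
    \<comment> \<open>Each of the \<open>a * b\<close> pairs is compared with at most
      \<open>a * b\<close> rows, the source of the square in the cost of
      \<open>classes\<close>.\<close>
    have "c * (100 * n + 30) \<le> (a * b) * (130 * n)" using cab n_pos by (intro mult_mono) auto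
    also have "\<dots> = 130 * (n * (a * b))" by simp
    finally have "c * (100 * n + 30) \<le> 130 * (n * (a * b))" .
    moreover have "n * 1 \<le> n * (a * b)" using ab by (rule mult_le_mono2)
    ultimately show "200 * n + 10 + (c * (100 * n + 30) + 60) \<le> 400 * (n * (a * b))"
      using n_pos by linarith
  qed
qed

lemma runs_classes:
  assumes Q: "\<And>s m R. frame (written_regs classes) (written_arrs classes) s0 s \<Longrightarrow>
      reg s ''c'' = m \<Longrightarrow> m \<le> nec1 {..<n} E (A \<union> B) \<Longrightarrow> class_rows m R s \<Longrightarrow>
      pair_entries m R ({..<a} \<times> {..<b}) s \<Longrightarrow> Q s"
    and ab: "1 \<le> a * b"
  shows "runs w classes s0 (500 * (n * (a * b) ^ 2)) Q"
proof -
  let ?s = "s0\<lparr>reg := (reg s0)(''c'' := 0)\<rparr>"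
  have loop: "runs w (For ''i'' ''a'' (For ''j'' ''b'' class_step)) ?s
      (5 + a * (b * (400 * (n * (a * b)) + 7) + 12)) (class_inv ({..<a} \<times> {..<b}))"
  proof (rule runs_For2[where Inv = class_inv and a = a and b = b and tb = "400 * (n * (a * b))"])
    fix i j D s1
    assume step: "i < a" "j < b" "(i, j) \<notin> D" "D \<subseteq> {..<a} \<times> {..<b}" "class_inv D s1"
      "reg s1 ''i'' = i" "reg s1 ''j'' = j"
      and f: "frame (insert ''i'' (insert ''j'' (written_regs class_step))) (written_arrs class_step) ?s s1"
    have "frame (written_regs classes) (written_arrs classes) s0 s1"
      using f by (auto simp: frame_def)
    with step show "runs w class_step s1 (400 * (n * (a * b))) (class_inv (insert (i, j) D))"
      by (rule runs_class_step)
  next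
    show "class_inv {} ?s"
      by (auto simp: class_inv_def class_rows_def pair_entries_def)
  next
    show "class_inv D (s\<lparr>reg := (reg s)(''i'' := v)\<rparr>) = class_inv D s"
      "class_inv D (s\<lparr>reg := (reg s)(''j'' := v)\<rparr>) = class_inv D s" for D s v
      by (simp_all add: class_inv_def class_rows_def pair_entries_def)
  qed (use regs le in \<open>simp_all add: fits\<close>)
  have "runs w classes s0 (2 + (5 + a * (b * (400 * (n * (a * b)) + 7) + 12))) (class_inv ({..<a} \<times> {..<b}))"
    unfolding classes_def
  proof (rule runs_seq[OF runs_wp[where B = 2]])
    show "wp w (Assign ''c'' (Num 0)) (\<lambda>s'. runs w (For ''i'' ''a'' (For ''j'' ''b'' class_step)) s'
      (5 + a * (b * (400 * (n * (a * b)) + 7) + 12)) (class_inv ({..<a} \<times> {..<b}))) s0"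
      using loop by (simp add: small_fits)
  qed simp_all
  then show ?thesis
  proof (rule runs_mono)
    have "1 \<le> b" using ab by (cases b) auto
    then have "a \<le> a * b" by simp
    moreover have 1: "1 \<le> n * (a * b)" using mult_le_mono[of 1 n 1 "a * b"] ab n_pos by linarith
    moreover have "a * b * 1 \<le> a * b * (n * (a * b))" using 1 by (intro mult_left_mono) auto
    moreover have "a * (b * (400 * (n * (a * b)) + 7) + 12) =
        400 * (a * b * (n * (a * b))) + 7 * (a * b) + 12 * a"
      by (simp add: algebra_simps)
    moreover have "n * (a * b) ^ 2 = a * b * (n * (a * b))" by (simp add: power2_eq_square)
    ultimately show "2 + (5 + a * (b * (400 * (n * (a * b)) + 7) + 12)) \<le> 500 * (n * (a * b) ^ 2)"
      using ab by linarith
  next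
    fix s' assume "class_inv ({..<a} \<times> {..<b}) s'"
      and f: "frame (written_regs classes) (written_arrs classes) s0 s'"
    then obtain R where R: "class_rows (reg s' ''c'') R s'"
      "pair_entries (reg s' ''c'') R ({..<a} \<times> {..<b}) s'"
      unfolding class_inv_def by blast
    from Q[OF f refl class_count_le[OF R(1)] R] show "Q s'" .
  qed
qed

end


section \<open>Combining the tables of two children\<close>

context merging
begin

text \<open>The middle conjunct is the premise on \<open>F\<close> in
  \<open>complete_table_union\<close>, restricted to the combinations already processed.\<close>

definition table_inv ::
  "nat \<Rightarrow> (nat \<Rightarrow> nat set) \<Rightarrow> (nat \<Rightarrow> nat \<Rightarrow> nat) \<Rightarrow> ((nat \<times> nat) \<times> (nat \<times> nat)) set \<Rightarrow> state \<Rightarrow> bool" where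
  "table_inv m R U D s \<longleftrightarrow>
     sound_table {..<n} E T (A \<union> B) m R (table_cell s p) \<and>
     (\<forall>((i, I), (j, J))\<in>D. 0 < table_cell s0 l i I \<longrightarrow> 0 < table_cell s0 r j J \<longrightarrow>
        no_edge E (RA i) (RB J) \<longrightarrow> no_edge E (RA I) (RB j) \<longrightarrow>
        table_cell s0 l i I + table_cell s0 r j J - 1 \<le> table_cell s p (U i j) (U I J)) \<and>
     (\<forall>q i j. q \<noteq> p \<longrightarrow> table_cell s q i j = table_cell s0 q i j)"

lemma table_invI:
  assumes "sound_table {..<n} E T (A \<union> B) m R (table_cell s p)"
    and covered: "\<And>i I j J. ((i, I), (j, J)) \<in> D \<Longrightarrow> 0 < table_cell s0 l i I \<Longrightarrow> 0 < table_cell s0 r j J \<Longrightarrow>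
        no_edge E (RA i) (RB J) \<Longrightarrow> no_edge E (RA I) (RB j) \<Longrightarrow>
        table_cell s0 l i I + table_cell s0 r j J - 1 \<le> table_cell s p (U i j) (U I J)"
    and "\<And>q i j. q \<noteq> p \<Longrightarrow> table_cell s q i j = table_cell s0 q i j"
  shows "table_inv m R U D s"
  unfolding table_inv_def Ball_def split_paired_All prod.case
  by (intro conjI allI impI) (fact assms(1), rule covered, assumption+, rule assms(3))

lemma runs_table_step:
  assumes sA: "sound_table {..<n} E T A a RA (table_cell s0 l)"
    and sB: "sound_table {..<n} E T B b RB (table_cell s0 r)"
    and s: "frame (written_regs classes \<union> written_regs table) ({''M'', ''F''} \<union> written_arrs classes) s0 s"
    and entries: "pair_entries m R ({..<a} \<times> {..<b}) s" and m: "m \<le> K"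
    and ij: "i < a" "I < a" "j < b" "J < b"
    and s_ij: "reg s ''i'' = i" "reg s ''I'' = I" "reg s ''j'' = j" "reg s ''J'' = J"
    and inv: "table_inv m R (\<lambda>i j. arr s ''U'' (pair i j)) D s"
  shows "runs w table_step s 300 (table_inv m R (\<lambda>i j. arr s ''U'' (pair i j)) (insert ((i, I), (j, J)) D))"
proof -
  let ?U = "\<lambda>i j. arr s ''U'' (pair i j)"
  let ?FA = "table_cell s0 l i I" and ?FB = "table_cell s0 r j J"
  let ?ok = "0 < ?FA \<and> 0 < ?FB \<and> no_edge E (RA i) (RB J) \<and> no_edge E (RA I) (RB j)"
  let ?g = "?U i j" and ?h = "?U I J"
  let ?Q = "table_inv m R ?U (insert ((i, I), (j, J)) D)"
  note inv' = inv[unfolded table_inv_def]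
  have sound: "sound_table {..<n} E T (A \<union> B) m R (table_cell s p)"
    using inv'[THEN conjunct1] .
  have covered: "table_cell s0 l i I + table_cell s0 r j J - 1 \<le> table_cell s p (?U i j) (?U I J)"
    if "((i, I), (j, J)) \<in> D" "0 < table_cell s0 l i I" "0 < table_cell s0 r j J"
      "no_edge E (RA i) (RB J)" "no_edge E (RA I) (RB j)" for i I j J
    using bspec[OF inv'[THEN conjunct2, THEN conjunct1] that(1)] that by simp
  have old: "table_cell s q i j = table_cell s0 q i j" if "q \<noteq> p" for q i j
    using inv'[THEN conjunct2, THEN conjunct2] that by blast
  have regs': "reg s ''p'' = p" "reg s ''l'' = l" "reg s ''r'' = r"
    using s regs by (simp_all add: frame_def)
  have FAB: "table_cell s l i I = ?FA" "table_cell s r j J = ?FB" using old le by simp_all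
  have FA_le: "?FA \<le> Suc n" and FB_le: "?FB \<le> Suc n"
    using sound_table_le[OF sA AB(2)] sound_table_le[OF sB AB(3)] ij by auto
  have gh: "?g < m" "?h < m"
    and bnd: "boundary {..<n} E (A \<union> B) (R ?g) = boundary {..<n} E (A \<union> B) (RA i \<union> RB j)"
      "boundary {..<n} E (A \<union> B) (R ?h) = boundary {..<n} E (A \<union> B) (RA I \<union> RB J)"
    and C: "arr s ''C'' (pair i J) = of_bool (\<not> no_edge E (RA i) (RB J))"
      "arr s ''C'' (pair I j) = of_bool (\<not> no_edge E (RA I) (RB j))"
    using entries ij unfolding pair_entries_def by auto
  have F_le: "table_cell s p ?g ?h \<le> Suc n"
    using sound_table_le[OF sound _ gh] AB by simp
  have K: "i \<le> K" "I \<le> K" "j \<le> K" "J \<le> K" "l \<le> K" "r \<le> K" "?g \<le> K" "?h \<le> K" "?FA \<le> K" "?FB \<le> K"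
    "?FA + ?FB \<le> K" "table_cell s p ?g ?h \<le> K"
    using ij le m gh FA_le FB_le F_le n_K by auto
  have unchanged: "?Q s'" if "arr s' ''F'' = arr s ''F''"
    "?ok \<Longrightarrow> ?FA + ?FB - 1 \<le> table_cell s p ?g ?h" for s'
    using that(2) sound covered old by (intro table_invI) (auto simp: that(1))
  \<comment> \<open>The union of the two witnesses justifies the new entry. Several combinations may
    share a cell since \<open>U\<close> need not be injective, but as entries only grow, the bounds
    obtained earlier persist.\<close>
  have changed: "?Q s'" if ok: "?ok" and lt: "table_cell s p ?g ?h < ?FA + ?FB - 1"
    and s': "arr s' ''F'' = (arr s ''F'')(triple p ?g ?h := ?FA + ?FB - 1)" for s'
  proof -
    obtain X where X: "realises {..<n} E T A X (RA i) (RA I)" "?FA = Suc (card X)"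
      using sA ij ok unfolding sound_table_def by blast
    obtain Y where Y: "realises {..<n} E T B Y (RB j) (RB J)" "?FB = Suc (card Y)"
      using sB ij ok unfolding sound_table_def by blast
    have "realises {..<n} E T (A \<union> B) (X \<union> Y) (RA i \<union> RB j) (RA I \<union> RB J)"
      using ok ij AB by (intro realises_union[OF _ _ _ _ _ _ _ X(1) Y(1)] RA RB) auto
    then have real: "realises {..<n} E T (A \<union> B) (X \<union> Y) (R ?g) (R ?h)"
      using realises_cong[OF bnd] by simp
    have "X \<subseteq> A" "Y \<subseteq> B" using X Y by (simp_all add: realises_def)
    then have "card (X \<union> Y) = card X + card Y"
      using AB finite_subset[of X "{..<n}"] finite_subset[of Y "{..<n}"]
      by (intro card_Un_disjoint) auto
    then have val: "?FA + ?FB - 1 = Suc (card (X \<union> Y))" using X Y by simp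
    have cell: "table_cell s' q i' j' = (if q = p \<and> i' = ?g \<and> j' = ?h then ?FA + ?FB - 1 else table_cell s q i' j')"
      for q i' j' by (simp add: s')
    have "sound_table {..<n} E T (A \<union> B) m R (table_cell s' p)"
      unfolding sound_table_def
    proof (intro allI impI)
      fix i' j' assume "i' < m" "j' < m" "0 < table_cell s' p i' j'"
      then show "\<exists>X. realises {..<n} E T (A \<union> B) X (R i') (R j') \<and> table_cell s' p i' j' = Suc (card X)"
        using sound real val unfolding sound_table_def cell by (cases "i' = ?g \<and> j' = ?h") auto
    qed
    moreover have mono: "table_cell s p i' j' \<le> table_cell s' p i' j'" for i' j'
      using lt unfolding cell by simp
    have "table_cell s0 l i1 I1 + table_cell s0 r j1 J1 - 1 \<le> table_cell s' p (?U i1 j1) (?U I1 J1)"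
      if "((i1, I1), (j1, J1)) \<in> insert ((i, I), (j, J)) D" "0 < table_cell s0 l i1 I1"
        "0 < table_cell s0 r j1 J1" "no_edge E (RA i1) (RB J1)" "no_edge E (RA I1) (RB j1)" for i1 I1 j1 J1
    proof (cases "((i1, I1), (j1, J1)) \<in> D")
      case True
      then show ?thesis using covered[OF True that(2-5)] mono le_trans by blast
    next
      case False
      then show ?thesis using that(1) cell by simp
    qed
    ultimately show ?thesis using old by (intro table_invI) (simp_all add: cell)
  qed
  show ?thesis
  proof (rule runs_wp)
    have "?FA + ?FB - 1 < 2 ^ w" "table_cell s p ?g ?h < 2 ^ w" "?FA + ?FB < 2 ^ w" "?FA < 2 ^ w" "?FB < 2 ^ w"
      using K n_K by (auto intro!: fits)
    note fits' = this
    show "wp w table_step ?Q s"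
    proof (cases "?ok \<and> table_cell s p ?g ?h < ?FA + ?FB - 1")
      case True
      then show ?thesis unfolding table_step_def using fits'
        by (auto simp: regs' s_ij FAB C fits K pair_fits triple_fits small_fits le intro!: changed)
    next
      case False
      then show ?thesis unfolding table_step_def using fits'
        by (auto simp: regs' s_ij FAB C fits K pair_fits triple_fits small_fits le intro!: unchanged)
    qed
  qed (simp add: table_step_def)
qed

lemma runs_table:
  assumes sA: "sound_table {..<n} E T A a RA (table_cell s0 l)"
    and sB: "sound_table {..<n} E T B b RB (table_cell s0 r)"
    and cA: "complete_table {..<n} E T A a RA (table_cell s0 l)"
    and cB: "complete_table {..<n} E T B b RB (table_cell s0 r)"
    and zero: "\<And>i j. table_cell s0 p i j = 0"
    and s: "frame (written_regs classes) ({''M''} \<union> written_arrs classes) s0 s"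
    and entries: "pair_entries m R ({..<a} \<times> {..<b}) s" and m: "m \<le> K"
    and ab: "1 \<le> a * b"
    and Q: "\<And>s'. frame (written_regs table) (written_arrs table) s s' \<Longrightarrow>
      sound_table {..<n} E T (A \<union> B) m R (table_cell s' p) \<Longrightarrow>
      complete_table {..<n} E T (A \<union> B) m R (table_cell s' p) \<Longrightarrow>
      (\<And>q i j. q \<noteq> p \<Longrightarrow> table_cell s' q i j = table_cell s0 q i j) \<Longrightarrow> Q s'"
  shows "runs w table s (400 * (a * b) ^ 2) Q"
proof -
  let ?U = "\<lambda>i j. arr s ''U'' (pair i j)" and ?all = "{..<b} \<times> {..<b}"
  let ?tb = "5 + b * (b * (300 + 7) + 12)"
  have regs': "reg s ''a'' = a" "reg s ''b'' = b" using s regs by (simp_all add: frame_def)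
  have ab_fits: "a < 2 ^ w" "b < 2 ^ w" using le by (auto intro: fits)
  have upd: "table_inv m R ?U D (s'\<lparr>reg := g\<rparr>) = table_inv m R ?U D s'" for D s' g
    by (simp add: table_inv_def)
  \<comment> \<open>All entries of \<open>p\<close> are still zero, so soundness is vacuous.\<close>
  have init: "table_inv m R ?U {} s"
  proof -
    have "table_cell s q i j = table_cell s0 q i j" for q i j using s by (simp add: frame_def)
    then show ?thesis by (simp add: table_inv_def sound_table_def zero)
  qed
  have body: "runs w table_step s2 300 (table_inv m R ?U (insert ((i, I), (j, J)) D))"
    if "i < a" "I < a" "j < b" "J < b" "reg s2 ''i'' = i" "reg s2 ''I'' = I" "reg s2 ''j'' = j" "reg s2 ''J'' = J"
      "table_inv m R ?U D s2" and f: "frame (written_regs table) (written_arrs table) s s2" for i I j J D s2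
  proof -
    have U: "arr s2 ''U'' = arr s ''U''" and C: "arr s2 ''C'' = arr s ''C''" using f by (simp_all add: frame_def)
    have "frame (written_regs classes \<union> written_regs table) ({''M'', ''F''} \<union> written_arrs classes) s0 s2"
      using s f by (auto simp: frame_def)
    moreover have "pair_entries m R ({..<a} \<times> {..<b}) s2"
      using entries unfolding pair_entries_def U C .
    ultimately show ?thesis
      using runs_table_step[OF sA sB _ _ m that(1-8), of R D] that(9) unfolding U by blast
  qed
  have "runs w table s (5 + a * (a * (?tb + 7) + 12)) (table_inv m R ?U (({..<a} \<times> {..<a}) \<times> ?all))"
    unfolding table_def
  proof (rule runs_For2[where Inv = "\<lambda>D. table_inv m R ?U (D \<times> ?all)" and a = a and b = a and tb = ?tb])
    fix i I D s1
    assume iI: "i < a" "I < a" and inv: "table_inv m R ?U (D \<times> ?all) s1"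
      and s1: "reg s1 ''i'' = i" "reg s1 ''I'' = I"
      and f: "frame (insert ''i'' (insert ''I'' (written_regs (For ''j'' ''b'' (For ''J'' ''b'' table_step)))))
        (written_arrs (For ''j'' ''b'' (For ''J'' ''b'' table_step))) s s1"
    show "runs w (For ''j'' ''b'' (For ''J'' ''b'' table_step)) s1 ?tb
        (table_inv m R ?U (insert (i, I) D \<times> ?all))"
    proof (rule runs_For2[where Inv = "\<lambda>D'. table_inv m R ?U (D \<times> ?all \<union> {(i, I)} \<times> D')"
          and a = b and b = b and tb = 300])
      fix j J D' s2
      assume jJ: "j < b" "J < b" and inv': "table_inv m R ?U (D \<times> ?all \<union> {(i, I)} \<times> D') s2"
        and s2: "reg s2 ''j'' = j" "reg s2 ''J'' = J"
        and f': "frame (insert ''j'' (insert ''J'' (written_regs table_step))) (written_arrs table_step) s1 s2"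
      have "reg s2 ''i'' = i" "reg s2 ''I'' = I" using f' s1 by (simp_all add: frame_def)
      moreover have "frame (written_regs table) (written_arrs table) s s2"
        using f f' by (auto simp: frame_def)
      ultimately have "runs w table_step s2 300
          (table_inv m R ?U (insert ((i, I), (j, J)) (D \<times> ?all \<union> {(i, I)} \<times> D')))"
        using iI jJ s2 inv' by (intro body)
      moreover have "insert ((i, I), (j, J)) (D \<times> ?all \<union> {(i, I)} \<times> D') =
          D \<times> ?all \<union> {(i, I)} \<times> insert (j, J) D'" by auto
      ultimately show "runs w table_step s2 300
          (table_inv m R ?U (D \<times> ?all \<union> {(i, I)} \<times> insert (j, J) D'))" by (simp only:)
    next
      fix s2 assume "table_inv m R ?U (D \<times> ?all \<union> {(i, I)} \<times> ?all) s2"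
      moreover have "D \<times> ?all \<union> {(i, I)} \<times> ?all = insert (i, I) D \<times> ?all" by auto
      ultimately show "table_inv m R ?U (insert (i, I) D \<times> ?all) s2" by (simp only:)
    next
      show "reg s1 ''b'' = b" using f regs' by (simp add: frame_def)
      then show "reg s1 ''b'' = b" .
    qed (use ab_fits inv upd in simp_all)
  qed (use ab_fits init upd regs' in simp_all)
  then show ?thesis
  proof (rule runs_mono)
    have "1 \<le> a" "1 \<le> b" using ab by (cases a; cases b; simp)+
    then have "a * 1 \<le> a * a" "b * 1 \<le> b * b" "a * a * 1 \<le> a * a * (b * b)" "1 * 1 \<le> a * a"
      by (intro mult_le_mono; simp)+
    moreover have "a * (a * (?tb + 7) + 12) = 307 * (a * a * (b * b)) + 12 * (a * a * b) + 12 * (a * a) + 12 * a"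
      by (simp add: algebra_simps)
    moreover have "a * a * b \<le> a * a * (b * b)" using \<open>1 \<le> b\<close> by (intro mult_le_mono) auto
    moreover have "(a * b) ^ 2 = a * a * (b * b)" by (simp add: power2_eq_square)
    ultimately show "5 + a * (a * (?tb + 7) + 12) \<le> 400 * (a * b) ^ 2"
      by linarith
  next
    fix s' assume inv: "table_inv m R ?U (({..<a} \<times> {..<a}) \<times> ?all) s'"
      and f: "frame (written_regs table) (written_arrs table) s s'"
    have "?U i j < m" "boundary {..<n} E (A \<union> B) (R (?U i j)) = boundary {..<n} E (A \<union> B) (RA i \<union> RB j)"
      if "i < a" "j < b" for i j
      using entries that unfolding pair_entries_def by auto
    then have "complete_table {..<n} E T (A \<union> B) m R (table_cell s' p)"
      using inv AB unfolding table_inv_def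
      by (intro complete_table_union[OF _ _ _ _ RA RB cA cB, where U = ?U]) auto
    then show "Q s'" using inv f unfolding table_inv_def by (intro Q) auto
  qed
qed

end


section \<open>Processing the nodes of the layout\<close>

lemma written_inner_node [simp]:
  "written_regs inner_node = {''r'', ''t'', ''l'', ''s'', ''a'', ''b''} \<union> written_regs classes \<union> written_regs table"
  "written_arrs inner_node = {''S'', ''M''} \<union> written_arrs classes \<union> written_arrs table"
  by (auto simp: inner_node_def inner_head_def simp del: written_blocks)

lemma written_leaf_node [simp]:
  "written_regs leaf_node = {''v'', ''o'', ''z'', ''u'', ''g''}"
  "written_arrs leaf_node = {''pos'', ''S'', ''M'', ''Z'', ''F''}"
  by (auto simp: leaf_node_def leaf_head_def leaf_tail_def)

lemma written_node_step [simp]: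
  "written_regs node_step = {''p''} \<union> written_regs inner_node \<union> written_regs leaf_node"
  "written_arrs node_step = written_arrs inner_node \<union> written_arrs leaf_node"
  by (auto simp: node_step_def simp del: written_inner_node written_leaf_node)

definition same_node :: "nat \<Rightarrow> state \<Rightarrow> state \<Rightarrow> bool" where
  "same_node q s s' \<longleftrightarrow> arr s' ''M'' q = arr s ''M'' q \<and> arr s' ''S'' q = arr s ''S'' q \<and>
     (\<forall>i j. row_cell s' q i j = row_cell s q i j) \<and> (\<forall>i j. table_cell s' q i j = table_cell s q i j)"

lemma same_node_trans: "same_node q s s' \<Longrightarrow> same_node q s' s'' \<Longrightarrow> same_node q s s''"
  by (simp add: same_node_def)

context word_ram
begin

text \<open>Representatives may be equivalent here, because of isolated vertices at leaves; the
  bound by twice \<open>nec1\<close> stands in for injectivity.\<close>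

definition solved :: "nat set set \<Rightarrow> nat set \<Rightarrow> nat set \<Rightarrow> nat \<Rightarrow> state \<Rightarrow> bool" where
  "solved E T A p s \<longleftrightarrow> arr s ''M'' p \<le> 2 * nec1 {..<n} E A \<and>
     (\<exists>R. (\<forall>i<arr s ''M'' p. R i \<subseteq> A \<and> (\<forall>v<n. row_cell s p i v = of_bool (code E A (R i) v))) \<and>
        sound_table {..<n} E T A (arr s ''M'' p) R (table_cell s p) \<and>
        complete_table {..<n} E T A (arr s ''M'' p) R (table_cell s p))"

lemma solved_same: "same_node p s s' \<Longrightarrow> solved E T A p s \<Longrightarrow> solved E T A p s'"
  by (simp add: same_node_def solved_def)

text \<open>The empty set is always a partial solution and needs an entry.\<close>

lemma complete_table_pos: "complete_table V E T A m R F \<Longrightarrow> 1 \<le> m"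
  unfolding complete_table_def by (metis empty_subsetI inf_bot_left less_one linorder_not_le no_edge_def empty_iff not_less_zero)

lemma runs_inner_node:
  assumes regs: "reg s ''n'' = n" "reg s ''p'' = q" "q \<le> K" "0 < q"
    and S: "arr s ''S'' (q - 1) = t" "0 < t" "t < q" "arr s ''S'' (t - 1) = b0" "b0 < t"
    and A: "solved E T A (t - 1) s" and B: "solved E T B (q - 1) s"
    and nec: "2 * nec1 {..<n} E A \<le> K" "2 * nec1 {..<n} E B \<le> K" "nec1 {..<n} E (A \<union> B) \<le> K"
    and AB: "A \<inter> B = {}" "A \<subseteq> {..<n}" "B \<subseteq> {..<n}"
    and pos: "\<And>v. v < n \<Longrightarrow> arr s ''pos'' v \<le> K"
      "\<And>v. v < n \<Longrightarrow> t < arr s ''pos'' v \<longleftrightarrow> v \<in> B"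
      "\<And>v. v < n \<Longrightarrow> b0 < arr s ''pos'' v \<longleftrightarrow> v \<in> A \<union> B"
    and zero: "\<And>i j. table_cell s q i j = 0"
    and Q: "\<And>s'. frame (written_regs inner_node) (written_arrs inner_node) s s' \<Longrightarrow>
      solved E T (A \<union> B) q s' \<Longrightarrow> arr s' ''S'' q = b0 \<Longrightarrow>
      (\<And>q'. q' \<noteq> q \<Longrightarrow> same_node q' s s') \<Longrightarrow> Q s'"
  shows "runs w inner_node s (1000 * (n * ((2 * nec1 {..<n} E A) * (2 * nec1 {..<n} E B)) ^ 2)) Q"
proof -
  define l r where "l = t - 1" and "r = q - 1"
  define a b where "a = arr s ''M'' l" and "b = arr s ''M'' r"
  have lr: "l < q" "r < q" "l \<noteq> q" "r \<noteq> q" using S regs by (auto simp: l_def r_def)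
  obtain RA where RA: "\<And>i. i < a \<Longrightarrow> RA i \<subseteq> A"
    "\<And>i v. i < a \<Longrightarrow> v < n \<Longrightarrow> row_cell s l i v = of_bool (code E A (RA i) v)"
    and sA: "sound_table {..<n} E T A a RA (table_cell s l)"
    and cA: "complete_table {..<n} E T A a RA (table_cell s l)"
    using A unfolding solved_def a_def l_def by blast
  obtain RB where RB: "\<And>j. j < b \<Longrightarrow> RB j \<subseteq> B"
    "\<And>j v. j < b \<Longrightarrow> v < n \<Longrightarrow> row_cell s r j v = of_bool (code E B (RB j) v)"
    and sB: "sound_table {..<n} E T B b RB (table_cell s r)"
    and cB: "complete_table {..<n} E T B b RB (table_cell s r)"
    using B unfolding solved_def b_def r_def by blast
  have a_le: "a \<le> 2 * nec1 {..<n} E A" and b_le: "b \<le> 2 * nec1 {..<n} E B"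
    using A B unfolding solved_def a_def b_def l_def r_def by blast+
  have ab: "1 \<le> a * b" using complete_table_pos[OF cA] complete_table_pos[OF cB] by simp
  have aK: "a \<le> K" "b \<le> K" using a_le b_le nec by auto
  have K': "t \<le> K" "b0 \<le> K" "l \<le> K" "r \<le> K" "q \<le> K" using S regs lr by auto
  \<comment> \<open>The state after \<open>inner_head\<close>, from which the merging of the
    children starts.\<close>
  define s1 where "s1 = s\<lparr>reg := (reg s)(''r'' := r, ''t'' := t, ''l'' := l, ''s'' := b0, ''a'' := a, ''b'' := b),
    arr := (arr s)(''S'' := (arr s ''S'')(q := b0))\<rparr>"
  have p: "reg s ''p'' = q" by (rule regs(2))
  interpret merging w K n E T A B q l r a b RA RB s1
  proof unfold_locales
    show "row_cell s1 l i v = of_bool (code E A (RA i) v)" if "i < a" "v < n" for i v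
      using RA that by (simp add: s1_def)
    show "row_cell s1 r j v = of_bool (code E B (RB j) v)" if "j < b" "v < n" for j v
      using RB that by (simp add: s1_def)
    show "arr s1 ''pos'' v \<le> K" "(reg s1 ''t'' < arr s1 ''pos'' v) = (v \<in> B)"
      "(reg s1 ''s'' < arr s1 ''pos'' v) = (v \<in> A \<union> B)" if "v < n" for v
      using pos[OF that] by (simp_all add: s1_def)
  qed (use regs K' lr aK nec AB RA RB in \<open>simp_all add: s1_def\<close>)
  let ?rest = "Seq classes (Seq (Store ''M'' (Reg ''p'') (Reg ''c'')) table)"
  have rest: "runs w ?rest s1 (900 * (n * (a * b) ^ 2) + 3) Q"
  proof (rule runs_seq)
    show "runs w classes s1 (500 * (n * (a * b) ^ 2))
      (\<lambda>s2. runs w (Seq (Store ''M'' (Reg ''p'') (Reg ''c'')) table) s2 (400 * (a * b) ^ 2 + 3) Q)"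
    proof (rule runs_classes[OF _ ab])
      fix s2 m R
      assume f2: "frame (written_regs classes) (written_arrs classes) s1 s2" and c: "reg s2 ''c'' = m"
        and m: "m \<le> nec1 {..<n} E (A \<union> B)" and R: "class_rows m R s2"
        and entries: "pair_entries m R ({..<a} \<times> {..<b}) s2"
      define s3 where "s3 = s2\<lparr>arr := (arr s2)(''M'' := (arr s2 ''M'')(q := m))\<rparr>"
      have p2: "reg s2 ''p'' = q" using f2 p by (simp add: frame_def s1_def)
      have mK: "m \<le> K" using m nec by simp
      have "runs w table s3 (400 * (a * b) ^ 2) Q"
      proof (rule runs_table[where R = R and m = m])
        show "frame (written_regs classes) ({''M''} \<union> written_arrs classes) s1 s3"
          using f2 by (auto simp: frame_def s3_def)
        show "pair_entries m R ({..<a} \<times> {..<b}) s3"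
          using entries by (simp add: pair_entries_def s3_def)
        show "table_cell s1 q i j = 0" for i j using zero by (simp add: s1_def)
      next
        fix s4
        assume f4: "frame (written_regs table) (written_arrs table) s3 s4"
          and tables: "sound_table {..<n} E T (A \<union> B) m R (table_cell s4 q)"
            "complete_table {..<n} E T (A \<union> B) m R (table_cell s4 q)"
          and old: "\<And>q' i j. q' \<noteq> q \<Longrightarrow> table_cell s4 q' i j = table_cell s1 q' i j"
        have M: "arr s4 ''M'' = (arr s ''M'')(q := m)" and S4: "arr s4 ''S'' = (arr s ''S'')(q := b0)"
          and Z: "arr s4 ''Z'' = arr s2 ''Z''"
          using f2 f4 by (simp_all add: frame_def s3_def s1_def)
        show "Q s4"
        proof (rule Q)
          show "frame (written_regs inner_node) (written_arrs inner_node) s s4"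
            using f2 f4 by (auto simp: frame_def s3_def s1_def)
          show "solved E T (A \<union> B) q s4"
            using R tables m unfolding solved_def M class_rows_def by (auto simp: Z)
          show "arr s4 ''S'' q = b0" by (simp add: S4)
          show "same_node q' s s4" if "q' \<noteq> q" for q'
            using R that old unfolding same_node_def class_rows_def by (simp add: M S4 Z s1_def)
        qed
      qed (use sA sB cA cB mK ab in \<open>simp_all add: s1_def\<close>)
      then show "runs w (Seq (Store ''M'' (Reg ''p'') (Reg ''c'')) table) s2 (400 * (a * b) ^ 2 + 3) Q"
        by (intro runs_seq[OF runs_wp[where B = 3], where ?B2.0 = "400 * (a * b) ^ 2"]) (use p2 c mK K' in \<open>simp_all add: fits s3_def\<close>)
    qed
    have "400 * (a * b) ^ 2 \<le> 400 * (n * (a * b) ^ 2)" using n_pos by simp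
    then show "500 * (n * (a * b) ^ 2) + (400 * (a * b) ^ 2 + 3) \<le> 900 * (n * (a * b) ^ 2) + 3" by linarith
  qed
  have "runs w inner_node s (900 * (n * (a * b) ^ 2) + 50) Q"
    unfolding inner_node_def
  proof (rule runs_seq[OF runs_wp[where B = 30]])
    have "arr s ''S'' r = t" "arr s ''S'' l = b0" "arr s ''M'' l = a" "arr s ''M'' r = b"
      "q - Suc 0 = r" "t - Suc 0 = l"
      using S by (simp_all add: l_def r_def a_def b_def)
    then show "wp w inner_head (\<lambda>s'. runs w ?rest s' (900 * (n * (a * b) ^ 2) + 3) Q) s"
      using rest p K'[THEN fits] aK[THEN fits] by (simp add: inner_head_def s1_def small_fits)
  qed (simp_all add: inner_head_def)
  then show ?thesis
  proof (rule runs_mono)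
    have "(a * b) ^ 2 \<le> ((2 * nec1 {..<n} E A) * (2 * nec1 {..<n} E B)) ^ 2"
      using a_le b_le by (intro power_mono mult_mono) auto
    then have 1: "n * (a * b) ^ 2 \<le> n * ((2 * nec1 {..<n} E A) * (2 * nec1 {..<n} E B)) ^ 2" by simp
    have "1 \<le> (a * b) ^ 2" using ab by (simp only: one_le_power)
    then have "1 * 1 \<le> n * (a * b) ^ 2" using n_pos by (intro mult_le_mono) auto
    with 1 show "900 * (n * (a * b) ^ 2) + 50 \<le>
        1000 * (n * ((2 * nec1 {..<n} E A) * (2 * nec1 {..<n} E B)) ^ 2)" by linarith
  qed
qed

lemma runs_leaf_node:
  assumes E: "\<forall>e\<in>E. card e = 2" and v: "v < n" and q: "q < K"
    and s: "reg s ''n'' = n" "reg s ''p'' = q" "arr s ''L'' q = Suc v"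
      "\<And>u. u < n \<Longrightarrow> arr s ''adj'' (v * n + u) = of_bool ({v, u} \<in> E)"
      "arr s ''T'' v = of_bool (v \<in> T)"
    and zero: "\<And>i j. row_cell s q i j = 0" "\<And>i j. table_cell s q i j = 0"
    and Q: "\<And>s'. frame (written_regs leaf_node) (written_arrs leaf_node) s s' \<Longrightarrow>
      solved E T {v} q s' \<Longrightarrow> arr s' ''S'' q = q \<Longrightarrow> arr s' ''pos'' = (arr s ''pos'')(v := Suc q) \<Longrightarrow>
      (\<And>q'. q' \<noteq> q \<Longrightarrow> same_node q' s s') \<Longrightarrow> Q s'"
  shows "runs w leaf_node s (1000 * n) Q"
proof -
  define s1 where "s1 = s\<lparr>reg := (reg s)(''v'' := v, ''o'' := 1, ''z'' := 0),
    arr := (arr s)(''pos'' := (arr s ''pos'')(v := Suc q), ''S'' := (arr s ''S'')(q := q),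
      ''M'' := (arr s ''M'')(q := 2))\<rparr>"
  define I where "I = (\<lambda>k (s' :: state). \<forall>p i u. row_cell s' p i u =
    (if p = q \<and> i = 1 \<and> u < k then of_bool ({v, u} \<in> E) else row_cell s p i u))"
  let ?g = "of_bool (v \<in> T) :: nat"
  have vK: "v \<le> K" "q \<le> K" "Suc q \<le> K" "Suc 0 \<le> K" "0 \<le> K" "?g \<le> K" using v q n_K by auto
  have loop: "runs w (For ''u'' ''n'' leaf_step) s1 (100 * n + 5) (\<lambda>s2. runs w leaf_tail s2 200 Q)"
  proof (rule runs_For[where I = I and h = n and tb = 93])
    fix k s2 assume k: "k < n" and I: "I k s2" and u: "reg s2 ''u'' = k"
      and f: "frame (insert ''u'' (written_regs leaf_step)) (written_arrs leaf_step) s1 s2"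
    have R: "reg s2 ''n'' = n" "reg s2 ''v'' = v" "reg s2 ''o'' = 1" "reg s2 ''p'' = q"
      "arr s2 ''adj'' = arr s ''adj''"
      using f s by (simp_all add: frame_def s1_def)
    have "v * n + k < n * n"
    proof -
      have "v * n + k < Suc v * n" using k by simp
      also have "\<dots> \<le> n * n" using v by (intro mult_le_mono1) simp
      finally show ?thesis .
    qed
    also have "n * n \<le> K * K" using n_le(2) by (intro mult_le_mono)
    also have "\<dots> \<le> 5 * K ^ 2" by (simp add: power2_eq_square)
    finally have adj: "v * n + k < 2 ^ w" using K K_le by linarith
    then have vn: "v * n < 2 ^ w" by simp
    have kK: "k \<le> K" using k n_le by simp
    show "runs w leaf_step s2 93 (I (Suc k))"
    proof (rule runs_wp)
      show "wp w leaf_step (I (Suc k)) s2"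
        using I k unfolding leaf_step_def I_def
        by (auto simp: R u s adj vn fits vK kK n_le pair_fits triple_fits small_fits less_Suc_eq)
    qed (simp add: leaf_step_def)
  next
    fix s2 assume I: "I n s2"
      and f: "frame (insert ''u'' (written_regs leaf_step)) (written_arrs leaf_step) s1 s2"
    have R: "reg s2 ''v'' = v" "reg s2 ''o'' = 1" "reg s2 ''z'' = 0" "reg s2 ''p'' = q"
      "arr s2 ''T'' = arr s ''T''" "arr s2 ''F'' = arr s ''F''"
      using f s by (simp_all add: frame_def s1_def)
    let ?s3 = "s2\<lparr>reg := (reg s2)(''g'' := ?g), arr := (arr s2)(''Z'' := (arr s2 ''Z'')(triple q 1 v := 1),
      ''F'' := (arr s ''F'')(triple q 0 0 := 1, triple q ?g 1 := 2))\<rparr>"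
    have M: "arr ?s3 ''M'' = (arr s ''M'')(q := 2)" "arr ?s3 ''S'' = (arr s ''S'')(q := q)"
      "arr ?s3 ''pos'' = (arr s ''pos'')(v := Suc q)"
      using f by (simp_all add: frame_def s1_def)
    have Z: "row_cell ?s3 p i u = (if p = q \<and> i = 1 \<and> u < n then of_bool (u = v \<or> {v, u} \<in> E)
        else row_cell s p i u)" for p i u
      using I v unfolding I_def by simp
    have F: "table_cell ?s3 p i j = (if p = q \<and> i = ?g \<and> j = 1 then 2 else if p = q \<and> i = 0 \<and> j = 0 then 1
        else table_cell s p i j)" for p i j
      by simp
    have "Q ?s3"
    proof (rule Q)
      show "frame (written_regs leaf_node) (written_arrs leaf_node) s ?s3"
        using f by (simp add: frame_def s1_def)
      have 1: "1 \<le> nec1 {..<n} E {v}" using v by (intro nec1_ge_1) auto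
      have 2: "leaf_rep v i \<subseteq> {v}" for i by (simp add: leaf_rep_def)
      have 3: "row_cell ?s3 q i u = of_bool (code E {v} (leaf_rep v i) u)" if "i < 2" "u < n" for i u
        unfolding Z using that zero by (auto simp: code_def leaf_rep_def less_2_cases_iff)
      have 4: "sound_table {..<n} E T {v} 2 (leaf_rep v) (table_cell ?s3 q)"
        "complete_table {..<n} E T {v} 2 (leaf_rep v) (table_cell ?s3 q)"
        unfolding F by (rule tables_leaf[OF E]; simp add: zero)+
      show "solved E T {v} q ?s3"
        unfolding solved_def M using 1 2 3 4 by (intro conjI exI[of _ "leaf_rep v"]) auto
      show "same_node q' s ?s3" if "q' \<noteq> q" for q'
        unfolding same_node_def Z F M using that by simp
    qed (use M in simp_all)
    then have "wp w leaf_tail Q s2"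
      unfolding leaf_tail_def
      by (simp add: R s fits vK pair_fits triple_fits small_fits)
    then show "runs w leaf_tail s2 200 Q" by (rule runs_wp[rotated]) (simp add: leaf_tail_def)
  next
    show "I 0 s1" by (simp add: I_def s1_def)
  next
    show "I k (s\<lparr>reg := (reg s)(''u'' := v)\<rparr>) = I k s" for k s v by (simp add: I_def)
  next
    show "reg s1 ''n'' = n" using s by (simp add: s1_def)
  qed (use n_le in \<open>simp_all add: fits\<close>)
  show ?thesis
    unfolding leaf_node_def
  proof (rule runs_seq[OF runs_wp[where B = 30], where ?B2.0 = "100 * n + 205"])
    have "runs w (Seq (For ''u'' ''n'' leaf_step) leaf_tail) s1 (100 * n + 205) Q"
      by (rule runs_seq[OF loop]) simp
    then show "wp w leaf_head (\<lambda>s'. runs w (Seq (For ''u'' ''n'' leaf_step) leaf_tail) s' (100 * n + 205) Q) s"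
      using s vK fits[of "Suc v"] v n_K by (simp add: leaf_head_def s1_def fits small_fits)
  qed (use n_pos in \<open>simp_all add: leaf_head_def\<close>)
qed

end


section \<open>The main loop on a whole layout\<close>

locale solving = word_ram +
  fixes E :: "nat set set" and T :: "nat set" and s0 :: state
  assumes graph: "simple_graph {..<n} E"
    and input: "reg s0 ''n'' = n" "reg s0 ''m'' \<le> K"
      "\<And>u v. u < n \<Longrightarrow> v < n \<Longrightarrow> arr s0 ''adj'' (v * n + u) = of_bool ({v, u} \<in> E)"
      "\<And>v. v < n \<Longrightarrow> arr s0 ''T'' v = of_bool (v \<in> T)"
begin

text \<open>Untouched cells are zero, as leaves and new tables require. The bound on
  \<open>pos\<close> ensures that vertices placed before \<open>q\<close> fail the test for lying in
  a subtree that starts at \<open>q\<close>.\<close>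

definition reached :: "nat \<Rightarrow> state \<Rightarrow> bool" where
  "reached q s \<longleftrightarrow> frame (written_regs node_step) (written_arrs node_step) s0 s \<and> reg s ''p'' = q \<and>
     (\<forall>p i j. q \<le> p \<longrightarrow> row_cell s p i j = 0 \<and> table_cell s p i j = 0) \<and>
     (\<forall>v<n. arr s ''pos'' v \<le> q)"

lemma reached_fixed:
  assumes "reached q s"
  shows "reg s ''n'' = n" "reg s ''m'' = reg s0 ''m''" "reg s ''p'' = q" "arr s ''L'' = arr s0 ''L''"
    "arr s ''adj'' = arr s0 ''adj''" "arr s ''T'' = arr s0 ''T''"
  using assms input unfolding reached_def by (simp_all add: frame_def)

lemma reached_Suc:
  assumes "reached q s" "frame (written_regs node_step) (written_arrs node_step) s s2"
    and "\<And>p. p \<noteq> q \<Longrightarrow> same_node p s s2" "\<And>v. v < n \<Longrightarrow> arr s2 ''pos'' v \<le> Suc q"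
  shows "reached (Suc q) (s2\<lparr>reg := (reg s2)(''p'' := Suc q)\<rparr>)"
proof -
  have "frame (written_regs node_step) (written_arrs node_step) s0 s2"
    using assms(1,2) unfolding reached_def by (blast intro: frame_trans)
  then have "frame (written_regs node_step) (written_arrs node_step) s0 (s2\<lparr>reg := (reg s2)(''p'' := Suc q)\<rparr>)"
    by (simp add: frame_def)
  moreover have "row_cell s2 p i j = 0 \<and> table_cell s2 p i j = 0" if "Suc q \<le> p" for p i j
    using assms(1) assms(3)[of p] that unfolding reached_def same_node_def by auto
  ultimately show ?thesis using assms(4) unfolding reached_def by simp
qed

text \<open>One unrolled round of the main loop: 11 is the loop test (3), the branching test (4) and
  the increment of \<open>p\<close> (4).\<close>

lemma runs_one_node:
  assumes s: "reached q s" "q < reg s0 ''m''" "arr s0 ''L'' q \<le> K"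
    and c: "c = (if arr s0 ''L'' q = 0 then inner_node else leaf_node)"
    and run: "runs w c s tb (\<lambda>s2. reg s2 ''p'' = q \<and>
      runs w main_loop (s2\<lparr>reg := (reg s2)(''p'' := Suc q)\<rparr>) B Q)"
    and B: "tb + 11 + B \<le> B'"
  shows "runs w main_loop s B' Q"
proof (rule runs_while_true[where ?B1.0 = "tb + 8" and ?B2.0 = B])
  note fixed = reached_fixed[OF s(1)]
  have qK: "q \<le> K" "Suc q \<le> K" using s(2) input(2) by auto
  show "bfits w (Less (Reg ''p'') (Reg ''m'')) s" "bval (Less (Reg ''p'') (Reg ''m'')) s"
    using s(2) input(2) qK by (simp_all add: fixed fits)
  have last: "runs w c s tb (\<lambda>s2. runs w (Assign ''p'' (Bin Plus (Reg ''p'') (Num 1))) s2 4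
      (\<lambda>s'. runs w main_loop s' B Q))"
    by (rule runs_mono[OF run order_refl], rule runs_wp) (use qK in \<open>simp_all add: fits small_fits\<close>)
  have branch: "runs w (If (Equal (Elem ''L'' (Reg ''p'')) (Num 0)) inner_node leaf_node) s (tb + 4)
      (\<lambda>s2. runs w (Assign ''p'' (Bin Plus (Reg ''p'') (Num 1))) s2 4 (\<lambda>s'. runs w main_loop s' B Q))"
    by (rule runs_if[where ?B1.0 = tb])
      (use last c s(3) qK in \<open>simp_all add: fixed fits small_fits split: if_splits\<close>)
  show "runs w node_step s (tb + 8) (\<lambda>s'. runs w main_loop s' B Q)"
    by (rule runs_seq[OF branch, folded node_step_def]) simp
qed (use B in simp)

text \<open>
  In continuation-passing style, so that the induction over the subtree unrolls one single loop.
\<close>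

lemma runs_subtree:
  assumes "set (leaves x) \<subseteq> {..<n}" "distinct (leaves x)"
    and "\<And>y. y \<in> nodes x \<Longrightarrow> 2 * nec1 {..<n} E (vertices_below y) \<le> K"
    and "\<And>i. i < length (postfix x) \<Longrightarrow> arr s0 ''L'' (b + i) = postfix x ! i"
    and "b + length (postfix x) \<le> reg s0 ''m''"
    and "reached b s" "\<And>v. v \<in> set (leaves x) \<Longrightarrow> arr s ''pos'' v = 0"
    and "\<And>s'. reached (b + length (postfix x)) s' \<Longrightarrow>
      solved E T (set (leaves x)) (b + length (postfix x) - 1) s' \<Longrightarrow>
      arr s' ''S'' (b + length (postfix x) - 1) = b \<Longrightarrow>
      (\<And>v. v \<in> set (leaves x) \<Longrightarrow> b < arr s' ''pos'' v) \<Longrightarrow>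
      (\<And>v. v < n \<Longrightarrow> v \<notin> set (leaves x) \<Longrightarrow> arr s' ''pos'' v = arr s ''pos'' v) \<Longrightarrow>
      (\<And>q. q < b \<Longrightarrow> same_node q s s') \<Longrightarrow> runs w main_loop s' B Q"
  shows "runs w main_loop s (2000 * n * work (\<lambda>y. 2 * nec1 {..<n} E (vertices_below y)) x + B) Q"
  using assms
proof (induction x arbitrary: b s B)
  case (Leaf v)
  have card2: "\<forall>e\<in>E. card e = 2" using graph by (simp add: simple_graph_def)
  have v: "v < n" using Leaf.prems(1) by simp
  have b: "b < reg s0 ''m''" using Leaf.prems(5) by simp
  then have bK: "b < K" using input(2) by simp
  have L: "arr s0 ''L'' b = Suc v" using Leaf.prems(4)[of 0] by simp
  note fixed = reached_fixed[OF Leaf.prems(6)]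
  show ?case
  proof (rule runs_one_node[OF Leaf.prems(6) b])
    show "runs w leaf_node s (1000 * n) (\<lambda>s2. reg s2 ''p'' = b \<and>
        runs w main_loop (s2\<lparr>reg := (reg s2)(''p'' := Suc b)\<rparr>) B Q)"
    proof (rule runs_leaf_node[OF card2 v bK])
      fix s2
      assume f: "frame (written_regs leaf_node) (written_arrs leaf_node) s s2"
        and sol: "solved E T {v} b s2" and S: "arr s2 ''S'' b = b"
        and pos: "arr s2 ''pos'' = (arr s ''pos'')(v := Suc b)"
        and same: "\<And>q'. q' \<noteq> b \<Longrightarrow> same_node q' s s2"
      have "frame (written_regs node_step) (written_arrs node_step) s s2"
        using f by (rule frame_mono) auto
      moreover have "arr s2 ''pos'' u \<le> Suc b" if "u < n" for u
        using Leaf.prems(6) that unfolding reached_def pos by (simp add: le_SucI)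
      ultimately have R: "reached (Suc b) (s2\<lparr>reg := (reg s2)(''p'' := Suc b)\<rparr>)"
        using same Leaf.prems(6) by (intro reached_Suc)
      have "runs w main_loop (s2\<lparr>reg := (reg s2)(''p'' := Suc b)\<rparr>) B Q"
        by (rule Leaf.prems(8)) (use R sol S pos same in \<open>auto simp: solved_def same_node_def\<close>)
      moreover have "reg s2 ''p'' = b" using f fixed by (simp add: frame_def)
      ultimately show "reg s2 ''p'' = b \<and> runs w main_loop (s2\<lparr>reg := (reg s2)(''p'' := Suc b)\<rparr>) B Q"
        by blast
    next
      show "arr s ''T'' v = of_bool (v \<in> T)" using input(4) v by (simp add: fixed)
    qed (use fixed L input v Leaf.prems(6) in \<open>simp_all add: reached_def\<close>)
    show "1000 * n + 11 + B \<le> 2000 * n * work (\<lambda>y. 2 * nec1 {..<n} E (vertices_below y)) (Leaf v) + B"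
      using n_pos by simp
  qed (use L v n_K in simp_all)
next
  case (Node l r)
  let ?N = "\<lambda>y. 2 * nec1 {..<n} E (vertices_below y)"
  define la lb where "la = length (postfix l)" and "lb = length (postfix r)"
  define A C where "A = set (leaves l)" and "C = set (leaves r)"
  define q where "q = b + la + lb"
  have pos_len: "0 < la" "0 < lb" unfolding la_def lb_def by (rule length_postfix_pos)+
  have len: "length (postfix (Node l r)) = Suc (la + lb)" by (simp add: la_def lb_def)
  have m: "q < reg s0 ''m''" using Node.prems(5) by (simp add: q_def la_def lb_def)
  have Lx: "arr s0 ''L'' (b + i) = (postfix l @ postfix r @ [0]) ! i" if "i < Suc (la + lb)" for i
    using Node.prems(4)[of i] that len by simp
  have Ll: "arr s0 ''L'' (b + i) = postfix l ! i" if "i < length (postfix l)" for i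
    using Lx[of i] that by (simp add: nth_append la_def)
  have Lr: "arr s0 ''L'' (b + la + i) = postfix r ! i" if "i < length (postfix r)" for i
    using Lx[of "la + i"] that by (simp add: nth_append la_def lb_def add.assoc)
  have Lq: "arr s0 ''L'' q = 0"
    using Lx[of "la + lb"] by (simp add: nth_append la_def lb_def q_def add.assoc)
  have AC: "A \<inter> C = {}" "A \<subseteq> {..<n}" "C \<subseteq> {..<n}"
    using Node.prems(1,2) by (auto simp: A_def C_def)
  have nec: "?N y \<le> K" if "y \<in> nodes (Node l r)" for y using Node.prems(3) that by blast
  have self: "y \<in> nodes y" for y :: "nat layout" by (cases y) auto
  have "runs w main_loop s (2000 * n * work ?N l +
      (2000 * n * work ?N r + (2000 * n * (?N l * ?N r) ^ 2 + B))) Q"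
  proof (rule Node.IH(1)[where b = b])
    fix s1
    assume R1: "reached (b + length (postfix l)) s1"
      and sol1: "solved E T (set (leaves l)) (b + length (postfix l) - 1) s1"
      and S1: "arr s1 ''S'' (b + length (postfix l) - 1) = b"
      and pos1: "\<And>v. v \<in> set (leaves l) \<Longrightarrow> b < arr s1 ''pos'' v"
      and opos1: "\<And>v. v < n \<Longrightarrow> v \<notin> set (leaves l) \<Longrightarrow> arr s1 ''pos'' v = arr s ''pos'' v"
      and same1: "\<And>q. q < b \<Longrightarrow> same_node q s s1"
    show "runs w main_loop s1 (2000 * n * work ?N r + (2000 * n * (?N l * ?N r) ^ 2 + B)) Q"
    proof (rule Node.IH(2)[where b = "b + la"])
      fix s2
      assume R2: "reached (b + la + length (postfix r)) s2"
        and sol2: "solved E T (set (leaves r)) (b + la + length (postfix r) - 1) s2"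
        and S2: "arr s2 ''S'' (b + la + length (postfix r) - 1) = b + la"
        and pos2: "\<And>v. v \<in> set (leaves r) \<Longrightarrow> b + la < arr s2 ''pos'' v"
        and opos2: "\<And>v. v < n \<Longrightarrow> v \<notin> set (leaves r) \<Longrightarrow> arr s2 ''pos'' v = arr s1 ''pos'' v"
        and same2: "\<And>q. q < b + la \<Longrightarrow> same_node q s1 s2"
      have Rq: "reached q s2" using R2 by (simp add: q_def lb_def)
      note fixed = reached_fixed[OF Rq]
      have qK: "q \<le> K" using m input(2) by simp
      have sl: "same_node (b + la - 1) s1 s2" using same2 pos_len by simp
      then have solA: "solved E T A (b + la - 1) s2"
        using solved_same[OF sl] sol1 by (simp add: A_def la_def)
      have SA: "arr s2 ''S'' (b + la - 1) = b" using sl S1 by (simp add: same_node_def la_def)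
      have solC: "solved E T C (q - 1) s2" and SC: "arr s2 ''S'' (q - 1) = b + la"
        using sol2 S2 by (simp_all add: C_def q_def lb_def)
      \<comment> \<open>A vertex not below the right child kept its value from the time when that
        subtree was entered, and then all values were at most \<open>b + la\<close>.\<close>
      have posC: "b + la < arr s2 ''pos'' v \<longleftrightarrow> v \<in> C" if "v < n" for v
      proof (cases "v \<in> C")
        case False
        then have "arr s2 ''pos'' v = arr s1 ''pos'' v" using opos2 that by (simp add: C_def)
        moreover have "arr s1 ''pos'' v \<le> b + la" using R1 that by (simp add: reached_def la_def)
        ultimately show ?thesis using False by simp
      qed (use pos2 in \<open>simp add: C_def\<close>)
      have posAC: "b < arr s2 ''pos'' v \<longleftrightarrow> v \<in> A \<union> C" if "v < n" for v
      proof (cases "v \<in> C")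
        case True
        then show ?thesis using posC[OF that] by simp
      next
        case False
        then have eq: "arr s2 ''pos'' v = arr s1 ''pos'' v" using opos2 that by (simp add: C_def)
        show ?thesis
        proof (cases "v \<in> A")
          case True
          then show ?thesis using pos1 eq by (simp add: A_def)
        next
          case vA: False
          then have "arr s1 ''pos'' v = arr s ''pos'' v" using opos1 that by (simp add: A_def)
          moreover have "arr s ''pos'' v \<le> b" using Node.prems(6) that by (simp add: reached_def)
          ultimately show ?thesis using eq vA False by simp
        qed
      qed
      show "runs w main_loop s2 (2000 * n * (?N l * ?N r) ^ 2 + B) Q"
      proof (rule runs_one_node[OF Rq m])
        show "runs w inner_node s2 (1000 * (n * (?N l * ?N r) ^ 2)) (\<lambda>s3. reg s3 ''p'' = q \<and>
            runs w main_loop (s3\<lparr>reg := (reg s3)(''p'' := Suc q)\<rparr>) B Q)"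
          unfolding vertices_below_def A_def[symmetric] C_def[symmetric]
        proof (rule runs_inner_node[where t = "b + la" and ?b0.0 = b and E = E and T = T])
          fix s3
          assume f: "frame (written_regs inner_node) (written_arrs inner_node) s2 s3"
            and sol3: "solved E T (A \<union> C) q s3" and S3: "arr s3 ''S'' q = b"
            and same3: "\<And>q'. q' \<noteq> q \<Longrightarrow> same_node q' s2 s3"
          let ?s = "s3\<lparr>reg := (reg s3)(''p'' := Suc q)\<rparr>"
          have pos3: "arr s3 ''pos'' = arr s2 ''pos''" and p3: "reg s3 ''p'' = q"
            using f fixed by (simp_all add: frame_def)
          have "frame (written_regs node_step) (written_arrs node_step) s2 s3"
            using f by (rule frame_mono) auto
          moreover have "arr s3 ''pos'' u \<le> Suc q" if "u < n" for u
            using Rq that unfolding reached_def pos3 by (simp add: le_SucI)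
          ultimately have R3: "reached (Suc q) ?s" using same3 Rq by (intro reached_Suc)
          have "runs w main_loop ?s B Q"
          proof (rule Node.prems(8))
            show "reached (b + length (postfix (Node l r))) ?s" using R3 len by (simp add: q_def add.assoc)
            show "solved E T (set (leaves (Node l r))) (b + length (postfix (Node l r)) - 1) ?s"
              using sol3 len by (simp add: solved_def q_def A_def C_def add.assoc)
            show "arr ?s ''S'' (b + length (postfix (Node l r)) - 1) = b"
              using S3 len by (simp add: q_def add.assoc)
            show "b < arr ?s ''pos'' v" if "v \<in> set (leaves (Node l r))" for v
              using posAC[of v] that AC by (auto simp: pos3 A_def C_def)
            show "arr ?s ''pos'' v = arr s ''pos'' v" if "v < n" "v \<notin> set (leaves (Node l r))" for v
              using opos1[of v] opos2[of v] that by (simp add: pos3)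
            show "same_node q' s ?s" if "q' < b" for q'
            proof -
              have "same_node q' s s3"
                using same1[OF that] same2[of q'] same3[of q'] that by (auto simp: q_def intro: same_node_trans)
              then show ?thesis by (simp add: same_node_def)
            qed
          qed
          then show "reg s3 ''p'' = q \<and> runs w main_loop ?s B Q" using p3 by blast
        next
          show "2 * nec1 {..<n} E A \<le> K" "2 * nec1 {..<n} E C \<le> K"
            using nec[of l] nec[of r] self by (simp_all add: vertices_below_def A_def C_def)
          show "nec1 {..<n} E (A \<union> C) \<le> K"
            using nec[of "Node l r"] by (simp add: vertices_below_def A_def C_def)
          show "arr s2 ''pos'' v \<le> K" if "v < n" for v
            using Rq that qK by (auto simp: reached_def intro: le_trans)
        qed (use fixed qK pos_len SA SC solA solC AC posC posAC Rq in \<open>simp_all add: q_def reached_def\<close>)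
        have "1 \<le> ?N l * ?N r"
          using nec1_ge_1[OF _ AC(2), of E] nec1_ge_1[OF _ AC(3), of E]
          by (simp add: vertices_below_def A_def C_def)
        then have "1 * 1 \<le> n * (?N l * ?N r) ^ 2"
          using n_pos by (intro mult_le_mono one_le_power) auto
        then show "1000 * (n * (?N l * ?N r) ^ 2) + 11 + B \<le> 2000 * n * (?N l * ?N r) ^ 2 + B"
          by linarith
      qed (use Lq in simp_all)
    next
      show "reached (b + la) s1" using R1 by (simp add: la_def)
      show "arr s1 ''pos'' v = 0" if "v \<in> set (leaves r)" for v
        using opos1[of v] that AC Node.prems(7)[of v] by (auto simp: A_def C_def)
      show "b + la + length (postfix r) \<le> reg s0 ''m''" using m by (simp add: q_def lb_def)
    qed (use AC Node.prems(2) nec Lr in \<open>auto simp: C_def\<close>)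
  next
    show "b + length (postfix l) \<le> reg s0 ''m''" using m by (simp add: q_def la_def)
  qed (use AC Node.prems(2,6,7) nec Ll in \<open>auto simp: A_def\<close>)
  then show ?case by (simp add: algebra_simps)
qed

lemma runs_finish:
  assumes sol: "solved E T {..<n} r s" and r: "r < K"
    and s: "reg s ''n'' = n" "reg s ''p'' = Suc r" "reg s ''k'' = k" "reg s ''answer'' = 0" "k < 2 ^ w"
  shows "runs w finish s 1000
    (\<lambda>s'. reg s' ''answer'' = (if subset_vertex_cover {..<n} E T k then 1 else 0))"
proof -
  define a where "a = arr s ''M'' r"
  obtain R where sound: "sound_table {..<n} E T {..<n} a R (table_cell s r)"
    and complete: "complete_table {..<n} E T {..<n} a R (table_cell s r)"
    using sol unfolding solved_def a_def by blast
  \<comment> \<open>Nothing lies outside the root, so it has one class and at most two indices; the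
    final maximum takes constant time.\<close>
  have "boundary {..<n} E {..<n} ` Pow {..<n} = {{}}" by (auto simp: boundary_def)
  then have a2: "a \<le> 2" using sol by (simp add: solved_def a_def nec1_eq_card_boundary)
  have aK: "a \<le> K" using a2 n_K by simp
  have le: "table_cell s r i j \<le> Suc n" if "i < a" "j < a" for i j
    using sound_table_le[OF sound _ that] by simp
  define s1 where "s1 = s\<lparr>reg := (reg s)(''r'' := r, ''a'' := a, ''x'' := 0)\<rparr>"
  define Inv where "Inv = (\<lambda>D (s' :: state). (\<forall>(i, j)\<in>D. table_cell s r i j \<le> reg s' ''x'') \<and>
    (reg s' ''x'' = 0 \<or> (\<exists>i<a. \<exists>j<a. reg s' ''x'' = table_cell s r i j)))"
  let ?Q = "\<lambda>s'. reg s' ''answer'' = (if subset_vertex_cover {..<n} E T k then 1 else 0)"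
  have loop: "runs w (For ''i'' ''a'' (For ''j'' ''a'' maximum_step)) s1
      (5 + a * (a * (100 + 7) + 12)) (\<lambda>s2. runs w finish_tail s2 20 ?Q)"
  proof (rule runs_For2[where Inv = Inv and a = a and b = a and tb = 100])
    fix i j D s2 assume ij: "i < a" "j < a" and I: "Inv D s2" and s2: "reg s2 ''i'' = i" "reg s2 ''j'' = j"
      and f: "frame (insert ''i'' (insert ''j'' (written_regs maximum_step))) (written_arrs maximum_step) s1 s2"
    have R: "reg s2 ''r'' = r" "arr s2 ''F'' = arr s ''F''" using f by (simp_all add: frame_def s1_def)
    have x: "reg s2 ''x'' \<le> Suc n" using I le unfolding Inv_def by auto
    have K': "i \<le> K" "j \<le> K" "r \<le> K" "table_cell s r i j \<le> K" "reg s2 ''x'' \<le> K"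
      using ij aK r le[OF ij] x n_K by auto
    have "Inv (insert (i, j) D) s2" if "\<not> reg s2 ''x'' < table_cell s r i j"
      using I that unfolding Inv_def by auto
    moreover have "Inv (insert (i, j) D) (s2\<lparr>reg := (reg s2)(''x'' := table_cell s r i j)\<rparr>)"
      if "reg s2 ''x'' < table_cell s r i j"
      using I that ij unfolding Inv_def by fastforce
    ultimately have "wp w maximum_step (Inv (insert (i, j) D)) s2"
      unfolding maximum_step_def using K' by (simp add: R s2 fits pair_fits triple_fits)
    then show "runs w maximum_step s2 100 (Inv (insert (i, j) D))"
      by (rule runs_wp[rotated]) (simp add: maximum_step_def)
  next
    fix s2 assume I: "Inv ({..<a} \<times> {..<a}) s2"
      and f: "frame (insert ''i'' (insert ''j'' (written_regs maximum_step))) (written_arrs maximum_step) s1 s2"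
    have R: "reg s2 ''n'' = n" "reg s2 ''k'' = k" "reg s2 ''answer'' = 0"
      using f s by (simp_all add: frame_def s1_def)
    let ?x = "reg s2 ''x''"
    have max: "table_cell s r i j \<le> ?x" if "i < a" "j < a" for i j
      using I that unfolding Inv_def by auto
    \<comment> \<open>The empty set makes the maximum positive, so \<open>x\<close> is an actual
      entry and soundness yields a set attaining it.\<close>
    have "no_edge E ({} \<inter> T) {}" by (simp add: no_edge_def)
    then obtain i j where "i < a" "j < a" "0 < table_cell s r i j"
      using complete unfolding complete_table_def by (metis empty_subsetI card.empty)
    then have x0: "0 < ?x" using max by (meson le_trans less_le_trans)
    then obtain i j where ij: "i < a" "j < a" "?x = table_cell s r i j"
      using I unfolding Inv_def by auto
    then obtain X where X: "realises {..<n} E T {..<n} X (R i) (R j)" "?x = Suc (card X)"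
      using sound x0 unfolding sound_table_def by metis
    have xn: "?x \<le> Suc n" using ij le by simp
    have "subset_vertex_cover {..<n} E T k \<longleftrightarrow> n + 1 - ?x \<le> k"
      unfolding subset_vertex_cover_iff[OF graph]
    proof
      assume "\<exists>X\<subseteq>{..<n}. no_edge E (X \<inter> T) X \<and> card {..<n} - card X \<le> k"
      then obtain Y where Y: "Y \<subseteq> {..<n}" "no_edge E (Y \<inter> T) Y" "n - card Y \<le> k" by auto
      then obtain i j where "i < a" "j < a" "card Y < table_cell s r i j"
        using complete unfolding complete_table_def by blast
      then have "card Y < ?x" using max by (meson less_le_trans)
      then show "n + 1 - ?x \<le> k" using Y by simp
    next
      assume "n + 1 - ?x \<le> k"
      then show "\<exists>X\<subseteq>{..<n}. no_edge E (X \<inter> T) X \<and> card {..<n} - card X \<le> k"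
        using X unfolding realises_def by (intro exI[of _ X]) auto
    qed
    moreover have "n + 1 \<le> K" "?x \<le> K" using n_K xn by auto
    ultimately have "wp w finish_tail ?Q s2"
      unfolding finish_tail_def using fits[of "Suc n"] fits[of ?x] s(5) n_le
      by (auto simp: R fits small_fits)
    then show "runs w finish_tail s2 20 ?Q" by (rule runs_wp[rotated]) (simp add: finish_tail_def)
  next
    show "Inv {} s1" by (simp add: Inv_def s1_def)
  next
    show "Inv D (s\<lparr>reg := (reg s)(''i'' := v)\<rparr>) = Inv D s" "Inv D (s\<lparr>reg := (reg s)(''j'' := v)\<rparr>) = Inv D s"
      for D s v by (simp_all add: Inv_def)
  qed (use aK in \<open>simp_all add: fits s1_def\<close>)
  have "a * (a * (100 + 7) + 12) \<le> 2 * (2 * (100 + 7) + 12)" using a2 by (intro mult_le_mono add_le_mono) auto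
  then have "5 + a * (a * (100 + 7) + 12) + 20 \<le> 900" by simp
  then have body: "runs w (Seq (For ''i'' ''a'' (For ''j'' ''a'' maximum_step)) finish_tail) s1 900 ?Q"
    by (rule runs_seq[OF loop])
  show ?thesis
    unfolding finish_def
  proof (rule runs_seq[OF runs_wp[where B = 20], where ?B2.0 = 900])
    show "wp w finish_head (\<lambda>s'. runs w (Seq (For ''i'' ''a'' (For ''j'' ''a'' maximum_step)) finish_tail)
        s' 900 ?Q) s"
      using body s r aK fits[of "Suc r"] by (simp add: finish_head_def s1_def a_def fits small_fits)
  qed (simp_all add: finish_head_def)
qed

end

section \<open>The whole program, its time bound and the word length\<close>

lemma runs_solver:
  assumes G: "simple_graph {..<n} E" and L: "rooted_layout {..<n} L"
    and K_bounds: "125 * K ^ 4 < 2 ^ w" "2 * n + 2 \<le> K"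
      "\<And>x. x \<in> nodes L \<Longrightarrow> 2 * nec1 {..<n} E (vertices_below x) \<le> K"
    and k: "k < 2 ^ w"
  shows "runs w solver (instance_state n E L T k)
    (5000 * n * work (\<lambda>y. 2 * nec1 {..<n} E (vertices_below y)) L)
    (\<lambda>s. reg s ''answer'' = (if subset_vertex_cover {..<n} E T k then 1 else 0))"
proof -
  let ?Q = "\<lambda>s. reg s ''answer'' = (if subset_vertex_cover {..<n} E T k then 1 else 0)"
  let ?N = "\<lambda>y. 2 * nec1 {..<n} E (vertices_below y)"
  define m where "m = n + n - 1"
  define s0 where "s0 = (instance_state n E L T k)\<lparr>reg := (reg (instance_state n E L T k))(''m'' := m)\<rparr>"
  have leaves: "set (leaves L) = {..<n}" "distinct (leaves L)" using L by (simp_all add: rooted_layout_def)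
  then have "length (leaves L) = n" by (metis card_lessThan distinct_card)
  then have len: "length (postfix L) = m" and m0: "0 < m"
    using length_postfix[of L] length_postfix_pos[of L] unfolding m_def by linarith+
  then have n0: "0 < n" by (cases n) (auto simp: m_def)
  interpret solving w K n E T s0
  proof
    show "arr s0 ''adj'' (v * n + u) = of_bool ({v, u} \<in> E)" if "u < n" "v < n" for u v
    proof -
      have "v * n + u < Suc v * n" using that by simp
      also have "\<dots> \<le> n * n" using that by (intro mult_le_mono1) simp
      finally have "v * n + u < n * n" .
      moreover have "(v * n + u) div n = v" "(v * n + u) mod n = u" using that by simp_all
      ultimately show ?thesis by (simp add: s0_def instance_state_def)
    qed
  qed (use G K_bounds n0 in \<open>simp_all add: s0_def instance_state_def m_def\<close>)
  \<comment> \<open>The continuation after the layout is \<open>finish\<close>; 1003 adds the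
    failing last test of the main loop to its budget of 1000.\<close>
  have main: "runs w main_loop s0 (2000 * n * work ?N L + 1003) (\<lambda>s. runs w finish s 1000 ?Q)"
  proof (rule runs_subtree[where b = 0])
    fix s'
    assume R: "reached (0 + length (postfix L)) s'"
      and sol: "solved E T (set (leaves L)) (0 + length (postfix L) - 1) s'"
    note fixed = reached_fixed[OF R]
    have mK: "m \<le> K" "m - 1 < K" using input(2) m0 by (simp_all add: s0_def)
    have regs: "reg s' ''m'' = m" "reg s' ''p'' = m" "reg s' ''k'' = k" "reg s' ''answer'' = 0"
      using R fixed len unfolding reached_def by (simp_all add: frame_def s0_def instance_state_def)
    have "runs w finish s' 1000 ?Q"
      by (rule runs_finish[where r = "m - 1"]) (use sol leaves(1) m0 mK fixed regs k in \<open>simp_all add: len\<close>)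
    then show "runs w main_loop s' 1003 (\<lambda>s. runs w finish s 1000 ?Q)"
      by (intro runs_while_false) (use regs mK in \<open>simp_all add: fits\<close>)
  next
    have "reg s0 ''p'' = 0" "arr s0 ''Z'' = (\<lambda>_. 0)" "arr s0 ''F'' = (\<lambda>_. 0)" "arr s0 ''pos'' = (\<lambda>_. 0)"
      by (simp_all add: s0_def instance_state_def)
    then show "reached 0 s0" by (simp add: reached_def frame_refl)
  qed (use leaves K_bounds len in \<open>simp_all add: s0_def instance_state_def\<close>)
  have "runs w solver (instance_state n E L T k) (6 + (2000 * n * work ?N L + 2003)) ?Q"
    unfolding solver_def
  proof (rule runs_seq[OF runs_wp[where B = 6], where ?B2.0 = "2000 * n * work ?N L + 2003"])
    have "runs w (Seq main_loop finish) s0 (2000 * n * work ?N L + 2003) ?Q"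
      by (rule runs_seq[OF main]) simp
    then show "wp w (Assign ''m'' (Bin Minus (Bin Plus (Reg ''n'') (Reg ''n'')) (Num 1)))
        (\<lambda>s. runs w (Seq main_loop finish) s (2000 * n * work ?N L + 2003) ?Q) (instance_state n E L T k)"
      using fits[of "n + n"] fits[of n] fits[of "n + n - 1"] n_K
      by (simp add: s0_def m_def instance_state_def small_fits)
  qed simp_all
  then show ?thesis
  proof (rule runs_mono)
    have "1 \<le> work N x" for N :: "nat layout \<Rightarrow> nat" and x by (induction x) auto
    then have "1 * 1 \<le> n * work ?N L" using n0 by (intro mult_le_mono) auto
    then show "6 + (2000 * n * work ?N L + 2003) \<le> 5000 * n * work ?N L" by linarith
  qed
qed

text \<open>For \<open>B\<close> the sum inside the logarithm, the word length gives
  \<open>B ^ 16 \<le> 2 ^ w\<close>. The doubling turns 125 into 2000, which is below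
  \<open>2 ^ 12\<close> and so below \<open>B ^ 12\<close> as \<open>B\<close> is at least 2; hence
  16 = 4 + 12.\<close>

lemma word_length_bound:
  assumes "sufficient_word_length 16 V E L w" and n: "1 \<le> card V"
    and "1 \<le> (\<Sum>x\<in>nodes L. nec1 V E (vertices_below x))"
  shows "125 * (2 * (card V + (\<Sum>x\<in>nodes L. nec1 V E (vertices_below x)))) ^ 4 < 2 ^ w"
proof -
  define B where "B = card V + (\<Sum>x\<in>nodes L. nec1 V E (vertices_below x))"
  have B: "2 \<le> B" using assms(2,3) by (simp add: B_def)
  have "real w \<ge> 16 * log 2 (real B)"
    using assms(1) unfolding sufficient_word_length_def B_def by simp
  then have "2 powr (16 * log 2 (real B)) \<le> 2 powr real w" by simp
  moreover have "2 powr (16 * log 2 (real B)) = (2 powr log 2 (real B)) powr 16"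
    by (simp add: powr_powr mult.commute)
  moreover have "\<dots> = real B ^ 16" using B by (simp add: powr_numeral)
  ultimately have "real (B ^ 16) \<le> real (2 ^ w)" by (simp add: powr_realpow)
  then have w: "B ^ 16 \<le> 2 ^ w" by (simp only: of_nat_le_iff)
  have "2000 < (2 :: nat) ^ 12" by simp
  also have "\<dots> \<le> B ^ 12" using B by (rule power_mono) simp
  finally have "2000 * B ^ 4 < B ^ 12 * B ^ 4" using B by (intro mult_strict_right_mono) auto
  also have "\<dots> = B ^ 16" by (simp flip: power_add)
  finally show ?thesis using w by (simp add: B_def[symmetric] power_mult_distrib)
qed

theorem theorem13:
  "\<exists>(prog :: com) (c :: real) (d :: real).
     \<forall>(n :: nat) (E :: nat set set) (L :: nat layout) (T :: nat set) (k :: nat) (w :: nat).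
       simple_graph {..<n} E \<longrightarrow> rooted_layout {..<n} L \<longrightarrow> T \<subseteq> {..<n} \<longrightarrow> k \<ge> 1 \<longrightarrow>
       sufficient_word_length d {..<n} E L w \<longrightarrow> k < 2 ^ w \<longrightarrow>
       (\<exists>t s. exec w prog (instance_state n E L T k) t s \<and>
          real t \<le> c * time_bound {..<n} E L \<and>
          reg s ''answer'' = (if subset_vertex_cover {..<n} E T k then 1 else 0))"
proof (rule exI[of _ solver], rule exI[of _ 480000], rule exI[of _ 16], intro allI impI)
  \<comment> \<open>The factor 480000 is 5000 * 2 * 16 * 3: from \<open>runs_solver\<close>, from
    \<open>work_le\<close>, from \<open>2 ^ 4\<close> for the doubled number of classes, and from
    \<open>sum_nec1_le_time_bound\<close>.\<close>
  fix n k w :: nat and E :: "nat set set" and L :: "nat layout" and T :: "nat set"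
  assume G: "simple_graph {..<n} E" and L: "rooted_layout {..<n} L"
    and w: "sufficient_word_length 16 {..<n} E L w" and k: "k < 2 ^ w"
  let ?c = "\<lambda>x. nec1 {..<n} E (vertices_below x)"
  \<comment> \<open>Doubled since a leaf may store twice as many rows as it has classes; as the sum
    is at least 1, this also gives \<open>2 * n + 2 \<le> K\<close>.\<close>
  define K where "K = 2 * (n + (\<Sum>x\<in>nodes L. ?c x))"
  have leaves: "set (leaves L) = {..<n}" "distinct (leaves L)" using L by (simp_all add: rooted_layout_def)
  have below: "vertices_below x \<subseteq> {..<n}" if "x \<in> nodes L" for x
    using leaves_subset_nodes[OF that] leaves by (simp add: vertices_below_def)
  have c1: "1 \<le> ?c x" if "x \<in> nodes L" for x
    using below[OF that] by (intro nec1_ge_1) auto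
  have c_le: "?c x \<le> (\<Sum>x\<in>nodes L. ?c x)" if "x \<in> nodes L" for x
    using that finite_nodes by (intro member_le_sum) auto
  have L_in: "L \<in> nodes L" by (cases L) auto
  have sum1: "1 \<le> (\<Sum>x\<in>nodes L. ?c x)" using c1[OF L_in] c_le[OF L_in] by linarith
  have n1: "1 \<le> n" using leaves leaves_nonempty[of L] by (cases n) auto
  have "125 * K ^ 4 < 2 ^ w"
    using word_length_bound[OF w] n1 sum1 by (simp add: K_def)
  moreover have "2 * n + 2 \<le> K" using sum1 by (simp add: K_def)
  moreover have "2 * ?c x \<le> K" if "x \<in> nodes L" for x using c_le[OF that] by (simp add: K_def)
  ultimately obtain t s where run: "exec w solver (instance_state n E L T k) t s"
    and t: "t \<le> 5000 * n * work (\<lambda>y. 2 * ?c y) L"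
    and answer: "reg s ''answer'' = (if subset_vertex_cover {..<n} E T k then 1 else 0)"
    using runs_solver[OF G L _ _ _ k, of K T] unfolding runs_def by blast
  have "work (\<lambda>y. 2 * ?c y) L \<le> 2 * (\<Sum>x\<in>nodes L. (2 * ?c x) ^ 4)"
  proof -
    have "1 \<le> 2 * ?c y" if "y \<in> nodes L" for y using c1[OF that] by simp
    from work_le[OF leaves(2), of "\<lambda>y. 2 * ?c y", OF this] show ?thesis by linarith
  qed
  also have "\<dots> = 32 * (\<Sum>x\<in>nodes L. ?c x ^ 4)" by (simp add: power_mult_distrib sum_distrib_left)
  finally have "5000 * n * work (\<lambda>y. 2 * ?c y) L \<le> 5000 * n * (32 * (\<Sum>x\<in>nodes L. ?c x ^ 4))"
    by (rule mult_le_mono2)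
  with t have "t \<le> 160000 * (n * (\<Sum>x\<in>nodes L. ?c x ^ 4))" by linarith
  then have "real t \<le> real (160000 * (n * (\<Sum>x\<in>nodes L. ?c x ^ 4)))" by (simp only: of_nat_le_iff)
  also have "\<dots> \<le> 480000 * time_bound {..<n} E L"
    using sum_nec1_le_time_bound[OF G L] by simp
  finally show "\<exists>t s. exec w solver (instance_state n E L T k) t s \<and>
      real t \<le> 480000 * time_bound {..<n} E L \<and>
      reg s ''answer'' = (if subset_vertex_cover {..<n} E T k then 1 else 0)"
    using run answer by blast
qed

end
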